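(* Let $G$ be a finite group. Then the group of singular orbit data $\mathbb{B}_G$ is isomorphic to $$\mathbb{Z}^{|T^+_G|}\oplus (\mathbb{Z}/2\mathbb{Z})^{|S_G|-n_{K'}}.$$
   Context: Let $G$ be a finite group. For $\gamma\in G$ let $\hat\gamma$ denote its conjugacy class and put $\hat\gamma^{-1}:=\widehat{\gamma^{-1}}$; $\hat G$ is the set of conjugacy classes. Let $\Lambda_G$ be the commutative monoid of finite (possibly empty) unordered tuples $[\hat\gamma_1,\ldots,\hat\gamma_q]_G$ of conjugacy classes of nontrivial elements of $G$ (repetitions allowed) such that $\gamma_1\cdots\gamma_q\in[G,G]$ (this does not depend on the order or on the representatives), with addition $\oplus$ given by concatenation. If the class of the identity appears in a written tuple, it is deleted. The group of singular orbit data is $\mathbb{B}_G=\Lambda_G/\langle[\hat\gamma,\hat\gamma^{-1}]_G : \gamma\in G\rangle$, i.e. two tuples are identified iff they have the same reduced form after deleting cancelling pairs $\hat\gamma,\hat\gamma^{-1}$. It is an abelian group with zero the empty tuple and $\ominus[\hat\gamma_1,\ldots,\hat\gamma_q]=[\hat\gamma_1^{-1},\ldots,\hat\gamma_q^{-1}]$. Put $S_G=\{\hat x\in\hat G : \hat x^{-1}=\hat x,\ x\neq 1\}$ and $T_G=\{\hat x\in\hat G : \hat x^{-1}\neq\hat x\}$. The set $T_G$ is the disjoint union of $T_G^+$ and $T_G^-=\{\hat x^{-1}:\hat x\in T_G^+\}$, i.e. $T_G^+$ contains exactly one member of each pair $\{\hat x,\hat x^{-1}\}\subset T_G$ (only its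 cardinality matters here). Let $G'=G/[G,G]$ and let $M_{G'}\subset G'$ be the set of those elements (cosets of $[G,G]$) which contain a conjugacy class $\hat x$ of $G$ with $\hat x^{-1}=\hat x$. Let $K'$ be the subgroup of $G'$ generated by $M_{G'}$; it is an elementary abelian $2$-group, and $n_{K'}$ denotes its rank, $K'\cong(\mathbb{Z}/2\mathbb{Z})^{n_{K'}}$. *)

theory Defs
  imports "HOL-Algebra.Group_Action" "HOL-Algebra.Product_Groups" "HOL-Library.Multiset"
begin

definition conj_class :: "('a, 'b) monoid_scheme \<Rightarrow> 'a \<Rightarrow> 'a set" where
  "conj_class G x = orbit G (\<lambda>g. \<lambda>h \<in> carrier G. g \<otimes>\<^bsub>G\<^esub> h \<otimes>\<^bsub>G\<^esub> inv\<^bsub>G\<^esub> g) x"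

text \<open>The unordered tuple of the conjugacy classes of the members of a list,
  the class of the identity being deleted.\<close>

definition class_tuple :: "('a, 'b) monoid_scheme \<Rightarrow> 'a list \<Rightarrow> 'a set multiset" where
  "class_tuple G gs = mset (map (conj_class G) (filter (\<lambda>g. g \<noteq> \<one>\<^bsub>G\<^esub>) gs))"

definition orbit_tuples :: "('a, 'b) monoid_scheme \<Rightarrow> 'a set multiset set" where
  "orbit_tuples G = {class_tuple G gs | gs. set gs \<subseteq> carrier G \<and>
     foldr (\<otimes>\<^bsub>G\<^esub>) gs \<one>\<^bsub>G\<^esub> \<in> derived G (carrier G)}"

definition cancelling_pairs :: "('a, 'b) monoid_scheme \<Rightarrow> 'a set multiset set" where
  "cancelling_pairs G = {class_tuple G [g, inv\<^bsub>G\<^esub> g] | g. g \<in> carrier G}"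

text \<open>The submonoid generated by the cancelling pairs consists of all finite sums of them.\<close>

definition cancelling_tuples :: "('a, 'b) monoid_scheme \<Rightarrow> 'a set multiset set" where
  "cancelling_tuples G = {\<Sum>\<^sub># P | P. set_mset P \<subseteq> cancelling_pairs G}"

text \<open>The quotient of a commutative monoid by a submonoid \<open>N\<close>: the least congruence
  identifying all of \<open>N\<close> with zero relates \<open>s\<close> and \<open>t\<close> iff
  \<open>s + a = t + b\<close> for some \<open>a\<close>, \<open>b\<close> in \<open>N\<close>.\<close>

definition orbit_rel :: "('a, 'b) monoid_scheme \<Rightarrow> ('a set multiset \<times> 'a set multiset) set" where
  "orbit_rel G = {(s, t). s \<in> orbit_tuples G \<and> t \<in> orbit_tuples G \<and>
     (\<exists>a \<in> cancelling_tuples G. \<exists>b \<in> cancelling_tuples G. s + a = t + b)}"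

definition singular_orbit_data :: "('a, 'b) monoid_scheme \<Rightarrow> 'a set multiset set monoid" where
  "singular_orbit_data G =
    \<lparr>carrier = orbit_tuples G // orbit_rel G,
     monoid.mult = (\<lambda>U V. \<Union>s \<in> U. \<Union>t \<in> V. orbit_rel G `` {s + t}),
     one = orbit_rel G `` {{#}}\<rparr>"

definition S_classes :: "('a, 'b) monoid_scheme \<Rightarrow> 'a set set" where
  "S_classes G = {conj_class G x | x. x \<in> carrier G \<and>
     conj_class G (inv\<^bsub>G\<^esub> x) = conj_class G x \<and> x \<noteq> \<one>\<^bsub>G\<^esub>}"

definition T_classes :: "('a, 'b) monoid_scheme \<Rightarrow> 'a set set" where
  "T_classes G = {conj_class G x | x. x \<in> carrier G \<and>
     conj_class G (inv\<^bsub>G\<^esub> x) \<noteq> conj_class G x}"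

definition inverse_classes :: "('a, 'b) monoid_scheme \<Rightarrow> 'a set set \<Rightarrow> 'a set set" where
  "inverse_classes G C = {conj_class G (inv\<^bsub>G\<^esub> x) | x. x \<in> carrier G \<and> conj_class G x \<in> C}"

text \<open>\<open>Tp\<close> contains exactly one member of each pair of distinct mutually inverse classes.\<close>

definition is_T_plus :: "('a, 'b) monoid_scheme \<Rightarrow> 'a set set \<Rightarrow> bool" where
  "is_T_plus G Tp \<longleftrightarrow>
     T_classes G = Tp \<union> inverse_classes G Tp \<and> Tp \<inter> inverse_classes G Tp = {}"

definition abelianization :: "('a, 'b) monoid_scheme \<Rightarrow> 'a set monoid" where
  "abelianization G = G Mod derived G (carrier G)"

definition M_cosets :: "('a, 'b) monoid_scheme \<Rightarrow> 'a set set" where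
  "M_cosets G = {C \<in> carrier (abelianization G). \<exists>x \<in> carrier G.
     conj_class G (inv\<^bsub>G\<^esub> x) = conj_class G x \<and> conj_class G x \<subseteq> C}"

definition K_group :: "('a, 'b) monoid_scheme \<Rightarrow> 'a set monoid" where
  "K_group G = subgroup_generated (abelianization G) (M_cosets G)"

definition free_abelian_power :: "nat \<Rightarrow> (nat \<Rightarrow> int) monoid" where
  "free_abelian_power n = product_group {..<n} (\<lambda>_. integer_group)"

definition Z2_power :: "nat \<Rightarrow> (nat \<Rightarrow> int) monoid" where
  "Z2_power n = product_group {..<n} (\<lambda>_. integer_mod_group 2)"

text \<open>For finite \<open>G\<close> the lemmas \<open>K_rank\<close> at the end show that the description is proper and
  that the rank is at most the number of members of \<open>S_classes G\<close>, so that subtracting it from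
  that number does not truncate.\<close>

definition K_rank :: "('a, 'b) monoid_scheme \<Rightarrow> nat" where
  "K_rank G = (THE n. K_group G \<cong> Z2_power n)"

subsection \<open>The quotient is an abelian group\<close>

lemma (in group) foldr_mult_closed:
  assumes "set xs \<subseteq> carrier G"
  shows "foldr (\<otimes>) xs \<one> \<in> carrier G"
  using assms by (induction xs) auto

lemma (in group) foldr_mult_append:
  assumes "set xs \<subseteq> carrier G" "set ys \<subseteq> carrier G"
  shows "foldr (\<otimes>) (xs @ ys) \<one> = foldr (\<otimes>) xs \<one> \<otimes> foldr (\<otimes>) ys \<one>"
  using assms by (induction xs) (auto simp: m_assoc foldr_mult_closed)

lemma (in group) foldr_mult_inv:
  assumes "set xs \<subseteq> carrier G"
  shows "foldr (\<otimes>) (rev (map (m_inv G) xs)) \<one> = inv (foldr (\<otimes>) xs \<one>)"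
  using assms
proof (induction xs)
  case (Cons x xs)
  have "foldr (\<otimes>) (rev (map (m_inv G) xs) @ [inv x]) \<one>
      = foldr (\<otimes>) (rev (map (m_inv G) xs)) \<one> \<otimes> foldr (\<otimes>) [inv x] \<one>"
    using Cons.prems by (intro foldr_mult_append) auto
  then show ?case
    using Cons by (simp add: inv_mult_group foldr_mult_closed)
qed simp

lemma class_tuple_append: "class_tuple G (xs @ ys) = class_tuple G xs + class_tuple G ys"
  by (simp add: class_tuple_def)

lemma class_tuple_rev: "class_tuple G (rev xs) = class_tuple G xs"
  by (simp add: class_tuple_def flip: rev_filter rev_map)

lemma class_tuple_Nil: "class_tuple G [] = {#}"
  by (simp add: class_tuple_def)

context group
begin

lemma subgroup_derived: "subgroup (derived G (carrier G)) G"
  by (simp add: derived_is_subgroup)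

lemma orbit_tuples_zero: "{#} \<in> orbit_tuples G"
  unfolding orbit_tuples_def
  using subgroup.one_closed[OF subgroup_derived] class_tuple_Nil by force

lemma orbit_tuples_add:
  assumes "s \<in> orbit_tuples G" "t \<in> orbit_tuples G"
  shows "s + t \<in> orbit_tuples G"
proof -
  obtain xs ys where
    xs: "s = class_tuple G xs" "set xs \<subseteq> carrier G" "foldr (\<otimes>) xs \<one> \<in> derived G (carrier G)"
    and ys: "t = class_tuple G ys" "set ys \<subseteq> carrier G" "foldr (\<otimes>) ys \<one> \<in> derived G (carrier G)"
    using assms unfolding orbit_tuples_def by auto
  have "s + t = class_tuple G (xs @ ys)" "set (xs @ ys) \<subseteq> carrier G"
    "foldr (\<otimes>) (xs @ ys) \<one> \<in> derived G (carrier G)"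
    using xs ys subgroup.m_closed[OF subgroup_derived]
    by (auto simp only: class_tuple_append foldr_mult_append set_append)
  then show ?thesis unfolding orbit_tuples_def by blast
qed

lemma cancelling_tuples_zero: "{#} \<in> cancelling_tuples G"
  unfolding cancelling_tuples_def by (auto intro: exI[of _ "{#}"])

lemma cancelling_tuples_add:
  assumes "a \<in> cancelling_tuples G" "b \<in> cancelling_tuples G"
  shows "a + b \<in> cancelling_tuples G"
proof -
  obtain P Q where "a = \<Sum>\<^sub># P" "b = \<Sum>\<^sub># Q"
    and "set_mset P \<subseteq> cancelling_pairs G" "set_mset Q \<subseteq> cancelling_pairs G"
    using assms unfolding cancelling_tuples_def by auto
  then have "a + b = \<Sum>\<^sub># (P + Q) \<and> set_mset (P + Q) \<subseteq> cancelling_pairs G" by simp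
  then show ?thesis unfolding cancelling_tuples_def by blast
qed

lemma orbit_tuples_inverse:
  assumes "s \<in> orbit_tuples G"
  obtains t where "t \<in> orbit_tuples G" "s + t \<in> cancelling_tuples G"
proof -
  obtain xs where
    xs: "s = class_tuple G xs" "set xs \<subseteq> carrier G" "foldr (\<otimes>) xs \<one> \<in> derived G (carrier G)"
    using assms unfolding orbit_tuples_def by auto
  let ?ys = "rev (map (m_inv G) xs)"
  have "class_tuple G ?ys \<in> orbit_tuples G"
    unfolding orbit_tuples_def mem_Collect_eq
    using xs foldr_mult_inv[OF xs(2)] subgroup.m_inv_closed[OF subgroup_derived xs(3)]
    by (intro exI[of _ ?ys]) auto
  moreover have "class_tuple G xs + class_tuple G (map (m_inv G) xs) \<in> cancelling_tuples G"
    using xs(2)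
  proof (induction xs)
    case Nil
    then show ?case by (simp add: class_tuple_Nil cancelling_tuples_zero)
  next
    case (Cons x xs)
    have "class_tuple G [x, inv x] = \<Sum>\<^sub># {#class_tuple G [x, inv x]#} \<and>
        set_mset {#class_tuple G [x, inv x]#} \<subseteq> cancelling_pairs G"
      using Cons.prems unfolding cancelling_pairs_def by auto
    then have "class_tuple G [x, inv x] \<in> cancelling_tuples G"
      unfolding cancelling_tuples_def by blast
    moreover have "class_tuple G (x # xs) + class_tuple G (map (m_inv G) (x # xs))
        = class_tuple G [x, inv x] + (class_tuple G xs + class_tuple G (map (m_inv G) xs))"
      by (simp add: class_tuple_def)
    ultimately show ?case using Cons cancelling_tuples_add by simp
  qed
  ultimately show ?thesis using that xs(1) by (simp add: class_tuple_rev)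
qed

lemma equiv_orbit_rel: "equiv (orbit_tuples G) (orbit_rel G)"
proof (rule equivI)
  show "orbit_rel G \<subseteq> orbit_tuples G \<times> orbit_tuples G"
    unfolding orbit_rel_def by auto
  show "refl_on (orbit_tuples G) (orbit_rel G)"
    unfolding refl_on_def orbit_rel_def using cancelling_tuples_zero by auto
  show "sym (orbit_rel G)"
    unfolding sym_def orbit_rel_def mem_Collect_eq case_prod_conv by metis
  show "trans (orbit_rel G)"
  proof (rule transI)
    fix s t u assume "(s, t) \<in> orbit_rel G" "(t, u) \<in> orbit_rel G"
    then obtain a b c d where "s \<in> orbit_tuples G" "u \<in> orbit_tuples G"
      and m: "a \<in> cancelling_tuples G" "b \<in> cancelling_tuples G"
        "c \<in> cancelling_tuples G" "d \<in> cancelling_tuples G"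
      and "s + a = t + b" "t + c = u + d"
      unfolding orbit_rel_def by auto
    moreover have "s + (a + c) = u + (b + d)"
    proof -
      have "s + (a + c) = (t + b) + c" using \<open>s + a = t + b\<close> by (simp flip: add.assoc)
      also have "\<dots> = (t + c) + b" by (simp only: ac_simps)
      also have "\<dots> = u + (b + d)" using \<open>t + c = u + d\<close> by (simp add: ac_simps)
      finally show ?thesis .
    qed
    ultimately show "(s, u) \<in> orbit_rel G"
      unfolding orbit_rel_def using cancelling_tuples_add by auto
  qed
qed

lemma orbit_rel_add:
  assumes "(s, s') \<in> orbit_rel G" "(t, t') \<in> orbit_rel G"
  shows "(s + t, s' + t') \<in> orbit_rel G"
proof -
  obtain a b c d where "a \<in> cancelling_tuples G" "b \<in> cancelling_tuples G"
      "c \<in> cancelling_tuples G" "d \<in> cancelling_tuples G"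
      and "s + a = s' + b" "t + c = t' + d"
    using assms unfolding orbit_rel_def by auto
  moreover have "s + t + (a + c) = s' + t' + (b + d)"
  proof -
    have "s + t + (a + c) = (s + a) + (t + c)" by (simp only: ac_simps)
    also have "\<dots> = s' + t' + (b + d)"
      unfolding \<open>s + a = s' + b\<close> \<open>t + c = t' + d\<close> by (simp only: ac_simps)
    finally show ?thesis .
  qed
  ultimately show ?thesis
    using assms unfolding orbit_rel_def by (auto intro: orbit_tuples_add cancelling_tuples_add)
qed

lemma mult_singular_orbit_data:
  assumes "s \<in> orbit_tuples G" "t \<in> orbit_tuples G"
  shows "orbit_rel G `` {s} \<otimes>\<^bsub>singular_orbit_data G\<^esub> orbit_rel G `` {t} = orbit_rel G `` {s + t}"
proof -
  have "congruent2 (orbit_rel G) (orbit_rel G) (\<lambda>s t. orbit_rel G `` {s + t})"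
    using orbit_rel_add by (intro congruent2I') (rule equiv_class_eq[OF equiv_orbit_rel])
  then show ?thesis
    using UN_equiv_class2[OF equiv_orbit_rel equiv_orbit_rel _ assms]
    by (simp add: singular_orbit_data_def)
qed

lemma comm_group_singular_orbit_data: "comm_group (singular_orbit_data G)"
proof -
  let ?B = "singular_orbit_data G" and ?q = "\<lambda>s. orbit_rel G `` {s}"
  have car: "carrier ?B = ?q ` orbit_tuples G"
    by (auto simp: singular_orbit_data_def quotient_def)
  have one: "\<one>\<^bsub>?B\<^esub> = ?q {#}"
    by (simp add: singular_orbit_data_def)
  show ?thesis
  proof (rule comm_groupI)
    fix X assume "X \<in> carrier ?B"
    then obtain s where s: "s \<in> orbit_tuples G" "X = ?q s" using car by auto
    then obtain t where t: "t \<in> orbit_tuples G" "s + t \<in> cancelling_tuples G"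
      using orbit_tuples_inverse by blast
    moreover have "t + s + {#} = {#} + (s + t)" by (simp add: add.commute)
    ultimately have "(t + s, {#}) \<in> orbit_rel G"
      unfolding orbit_rel_def mem_Collect_eq case_prod_conv
      using s cancelling_tuples_zero orbit_tuples_add orbit_tuples_zero by blast
    then have "?q t \<otimes>\<^bsub>?B\<^esub> X = \<one>\<^bsub>?B\<^esub>"
      using s t one mult_singular_orbit_data equiv_class_eq[OF equiv_orbit_rel] by simp
    then show "\<exists>Y\<in>carrier ?B. Y \<otimes>\<^bsub>?B\<^esub> X = \<one>\<^bsub>?B\<^esub>"
      using car t by blast
  qed (auto simp: car one mult_singular_orbit_data orbit_tuples_add orbit_tuples_zero ac_simps)
qed

end

subsection \<open>The rank is well defined and at most the number of real nontrivial classes\<close>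

lemma card_Z2_power: "card (carrier (Z2_power n)) = 2 ^ n"
  by (simp add: Z2_power_def card_PiE carrier_integer_mod_group)

lemma group_Z2_power: "group (Z2_power n)"
  by (simp add: Z2_power_def)

lemma (in comm_group) generate_insert_involution:
  assumes A: "A \<subseteq> carrier G" and a: "a \<in> carrier G" "a \<otimes> a = \<one>"
  shows "generate G (insert a A) = generate G A \<union> (\<lambda>k. k \<otimes> a) ` generate G A"
proof -
  let ?K = "generate G A"
  interpret K: subgroup ?K G
    using generate_is_subgroup[OF A] .
  have Kc: "k \<in> carrier G" if "k \<in> ?K" for k using that by auto
  have ia: "inv a = a" using a by (simp add: inv_equality)
  have aa: "k \<otimes> a \<otimes> (l \<otimes> a) = k \<otimes> l" if "k \<in> ?K" "l \<in> ?K" for k l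
  proof -
    have "k \<otimes> a \<otimes> (l \<otimes> a) = k \<otimes> l \<otimes> (a \<otimes> a)"
      using a(1) Kc that by (simp add: m_ac)
    then show ?thesis using a(2) Kc that by simp
  qed
  have "subgroup (?K \<union> (\<lambda>k. k \<otimes> a) ` ?K) G"
  proof (rule subgroup.intro)
    fix x y assume "x \<in> ?K \<union> (\<lambda>k. k \<otimes> a) ` ?K" "y \<in> ?K \<union> (\<lambda>k. k \<otimes> a) ` ?K"
    then consider (1) "x \<in> ?K" "y \<in> ?K"
      | (2) l where "x \<in> ?K" "l \<in> ?K" "y = l \<otimes> a"
      | (3) k where "k \<in> ?K" "x = k \<otimes> a" "y \<in> ?K"
      | (4) k l where "k \<in> ?K" "x = k \<otimes> a" "l \<in> ?K" "y = l \<otimes> a"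
      by blast
    then show "x \<otimes> y \<in> ?K \<union> (\<lambda>k. k \<otimes> a) ` ?K"
    proof cases
      case 2
      then have "x \<otimes> y = (x \<otimes> l) \<otimes> a" using a Kc by (simp add: m_assoc)
      then show ?thesis using 2 by blast
    next
      case 3
      then have "x \<otimes> y = (k \<otimes> y) \<otimes> a" using a Kc by (simp add: m_ac)
      then show ?thesis using 3 by blast
    next
      case 4
      then show ?thesis using aa[of k l] K.m_closed by simp
    qed (use K.m_closed in blast)
  next
    fix x assume "x \<in> ?K \<union> (\<lambda>k. k \<otimes> a) ` ?K"
    then consider (1) "x \<in> ?K" | (2) k where "k \<in> ?K" "x = k \<otimes> a" by blast
    then show "inv x \<in> ?K \<union> (\<lambda>k. k \<otimes> a) ` ?K"
    proof cases
      case 1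
      then show ?thesis using K.m_inv_closed by blast
    next
      case 2
      then have "inv x = inv k \<otimes> a" using a(1) ia Kc by (simp add: inv_mult)
      then show ?thesis using K.m_inv_closed[OF 2(1)] by blast
    qed
  next
    show "?K \<union> (\<lambda>k. k \<otimes> a) ` ?K \<subseteq> carrier G" using a(1) Kc by blast
    show "\<one> \<in> ?K \<union> (\<lambda>k. k \<otimes> a) ` ?K" using K.one_closed by blast
  qed
  moreover have "insert a A \<subseteq> ?K \<union> (\<lambda>k. k \<otimes> a) ` ?K"
  proof -
    have "a = \<one> \<otimes> a" using a by simp
    then have "a \<in> (\<lambda>k. k \<otimes> a) ` ?K" using K.one_closed by blast
    moreover have "A \<subseteq> ?K" by (rule subsetI, rule generate.incl)
    ultimately show ?thesis by blast
  qed
  ultimately have "generate G (insert a A) \<subseteq> ?K \<union> (\<lambda>k. k \<otimes> a) ` ?K"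
    by (rule generate_subgroup_incl[rotated])
  moreover have "?K \<subseteq> generate G (insert a A)"
    by (rule mono_generate) auto
  moreover have "k \<otimes> a \<in> generate G (insert a A)" if "k \<in> ?K" for k
    using that \<open>?K \<subseteq> generate G (insert a A)\<close>
    by (intro generate.eng) (auto intro: generate.incl)
  ultimately show ?thesis by blast
qed

lemma (in comm_group) generate_involutions_iso:
  assumes "finite A" "A \<subseteq> carrier G" "\<And>a. a \<in> A \<Longrightarrow> a \<otimes> a = \<one>"
  shows "\<exists>n \<le> card A. \<exists>f. f \<in> iso (Z2_power n) (G\<lparr>carrier := generate G A\<rparr>)"
  using assms
proof (induction A rule: finite_induct)
  case empty
  have "(\<lambda>_. \<one>) \<in> iso (Z2_power 0) (G\<lparr>carrier := generate G {}\<rparr>)"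
    by (auto simp: Z2_power_def iso_iff hom_def generate_empty)
  then show ?case by auto
next
  case (insert a A)
  then obtain n f where n: "n \<le> card A"
    and f: "f \<in> iso (Z2_power n) (G\<lparr>carrier := generate G A\<rparr>)" by auto
  let ?K = "generate G A"
  have a: "a \<in> carrier G" "a \<otimes> a = \<one>" and A: "A \<subseteq> carrier G"
    using insert.prems by auto
  interpret K: subgroup ?K G
    using generate_is_subgroup[OF A] .
  show ?case
  proof (cases "a \<in> ?K")
    case True
    then have "generate G (insert a A) = ?K"
      using generate_insert_involution[OF A a] K.m_closed by auto
    then show ?thesis using n f insert.hyps by (auto intro!: exI[of _ n])
  next
    case False
    let ?r = "\<lambda>x. restrict x {..<n}"
    define g where "g x = f (?r x) \<otimes> (if x n = 0 then \<one> else a)" for x :: "nat \<Rightarrow> int"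
    have fK: "f ` carrier (Z2_power n) = ?K" and finj: "inj_on f (carrier (Z2_power n))"
      and fm: "\<And>x y. x \<in> carrier (Z2_power n) \<Longrightarrow> y \<in> carrier (Z2_power n) \<Longrightarrow>
        f (x \<otimes>\<^bsub>Z2_power n\<^esub> y) = f x \<otimes> f y"
      using f by (auto simp: iso_iff hom_def)
    have r: "?r x \<in> carrier (Z2_power n)" if "x \<in> carrier (Z2_power (Suc n))" for x
      using that by (auto simp: Z2_power_def PiE_def Pi_def)
    have xn: "x n = 0 \<or> x n = 1" if "x \<in> carrier (Z2_power (Suc n))" for x
    proof -
      have "x n \<in> {0..<2}" using that by (auto simp: Z2_power_def PiE_def Pi_def carrier_integer_mod_group)
      then show ?thesis by auto
    qed
    have fr: "f (?r x) \<in> ?K" if "x \<in> carrier (Z2_power (Suc n))" for x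
      using r[OF that] fK by blast
    have gm: "g (x \<otimes>\<^bsub>Z2_power (Suc n)\<^esub> y) = g x \<otimes> g y"
      if x: "x \<in> carrier (Z2_power (Suc n))" and y: "y \<in> carrier (Z2_power (Suc n))" for x y
    proof -
      have "?r (x \<otimes>\<^bsub>Z2_power (Suc n)\<^esub> y) = ?r x \<otimes>\<^bsub>Z2_power n\<^esub> ?r y"
        by (auto simp: Z2_power_def fun_eq_iff)
      then have 1: "f (?r (x \<otimes>\<^bsub>Z2_power (Suc n)\<^esub> y)) = f (?r x) \<otimes> f (?r y)"
        using fm r x y by simp
      have 2: "(x \<otimes>\<^bsub>Z2_power (Suc n)\<^esub> y) n = (x n + y n) mod 2"
        by (simp add: Z2_power_def)
      have c: "f (?r x) \<in> carrier G" "f (?r y) \<in> carrier G"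
        using fr x y by auto
      have 3: "f (?r x) \<otimes> a \<otimes> (f (?r y) \<otimes> a) = f (?r x) \<otimes> f (?r y)"
      proof -
        have "f (?r x) \<otimes> a \<otimes> (f (?r y) \<otimes> a) = f (?r x) \<otimes> f (?r y) \<otimes> (a \<otimes> a)"
          using a(1) c by (simp add: m_ac)
        then show ?thesis using a(2) c by simp
      qed
      show ?thesis
        unfolding g_def 1 2 using xn[OF x] xn[OF y] c a 3 by (auto simp: m_ac simp del: m_assoc)
    qed
    have ginj: "inj_on g (carrier (Z2_power (Suc n)))"
    proof (rule inj_onI)
      fix x y assume x: "x \<in> carrier (Z2_power (Suc n))" and y: "y \<in> carrier (Z2_power (Suc n))"
        and eq: "g x = g y"
      have c: "f (?r x) \<in> carrier G" "f (?r y) \<in> carrier G"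
        using fr x y by auto
      have nk: "k \<otimes> a \<noteq> l" if "k \<in> ?K" "l \<in> ?K" for k l
      proof
        assume "k \<otimes> a = l"
        then have "a = inv k \<otimes> l" using that a K.mem_carrier
          by (metis inv_solve_left)
        then show False using False that by auto
      qed
      have "x n = y n \<and> f (?r x) = f (?r y)"
        using xn[OF x] xn[OF y] eq c a(1) nk[OF fr[OF x] fr[OF y]] nk[OF fr[OF y] fr[OF x]]
        by (auto simp: g_def)
      then have e: "x n = y n" "?r x = ?r y"
        using finj r x y by (auto dest: inj_onD)
      show "x = y"
      proof (rule PiE_ext)
        show "x \<in> PiE {..<Suc n} (\<lambda>_. UNIV)" "y \<in> PiE {..<Suc n} (\<lambda>_. UNIV)"
          using x y by (auto simp: Z2_power_def PiE_def)
        fix i assume "i \<in> {..<Suc n}"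
        then have "i = n \<or> i \<in> {..<n}" by auto
        then show "x i = y i" using e by (metis restrict_apply')
      qed
    qed
    have gim: "g ` carrier (Z2_power (Suc n)) = ?K \<union> (\<lambda>k. k \<otimes> a) ` ?K"
    proof
      show "g ` carrier (Z2_power (Suc n)) \<subseteq> ?K \<union> (\<lambda>k. k \<otimes> a) ` ?K"
        using fr by (auto simp: g_def)
    next
      have "k \<in> g ` carrier (Z2_power (Suc n)) \<and> k \<otimes> a \<in> g ` carrier (Z2_power (Suc n))"
        if k: "k \<in> ?K" for k
      proof -
        obtain x where x: "x \<in> carrier (Z2_power n)" "k = f x"
          using fK k by blast
        have up: "x(n := j) \<in> carrier (Z2_power (Suc n))" if "j \<in> {0, 1}" for j
          using x(1) that
          by (auto simp: Z2_power_def PiE_def Pi_def extensional_def carrier_integer_mod_group)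
        have "?r (x(n := j)) = x" for j
          using x(1) by (auto simp: Z2_power_def PiE_def extensional_def fun_eq_iff)
        then have "g (x(n := 0)) = k" "g (x(n := 1)) = k \<otimes> a"
          using x k by (simp_all add: g_def)
        then show ?thesis using up[of 0] up[of 1]
          by (metis image_eqI insertCI)
      qed
      then show "?K \<union> (\<lambda>k. k \<otimes> a) ` ?K \<subseteq> g ` carrier (Z2_power (Suc n))" by blast
    qed
    have "g \<in> iso (Z2_power (Suc n)) (G\<lparr>carrier := generate G (insert a A)\<rparr>)"
      unfolding iso_iff hom_def generate_insert_involution[OF A a]
      using gim ginj gm by auto
    then show ?thesis using n insert.hyps by (auto intro!: exI[of _ "Suc n"])
  qed
qed

context group
begin

lemma conj_class_eq: "conj_class G x = {g \<otimes> x \<otimes> inv g | g. g \<in> carrier G}" if "x \<in> carrier G"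
  using that by (auto simp: conj_class_def orbit_def)

lemma conj_class_self: "x \<in> conj_class G x" if "x \<in> carrier G"
  using that conj_class_eq[OF that] by (auto intro!: exI[of _ \<one>])

lemma M_cosets_square:
  assumes "C \<in> M_cosets G"
  shows "C \<otimes>\<^bsub>abelianization G\<^esub> C = \<one>\<^bsub>abelianization G\<^esub>"
proof -
  let ?D = "derived G (carrier G)"
  interpret D: normal ?D G using derived_self_is_normal .
  obtain x where x: "x \<in> carrier G" "conj_class G (inv x) = conj_class G x" "conj_class G x \<subseteq> C"
    using assms unfolding M_cosets_def by auto
  obtain y where y: "y \<in> carrier G" "C = ?D #> y"
    using assms by (auto simp: M_cosets_def abelianization_def FactGroup_def RCOSETS_def)
  have "x \<in> C" "inv x \<in> C"
    using x conj_class_self[of x] conj_class_self[of "inv x"] by auto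
  then have "C = ?D #> x" "C = ?D #> inv x"
    using y repr_independence D.subgroup_axioms by auto
  then have "C <#> C = ?D #> (x \<otimes> inv x)"
    using x D.rcos_sum[of x "inv x"] by simp
  then show ?thesis
    using x D.subset by (simp add: abelianization_def FactGroup_def)
qed

lemma finite_S_classes:
  assumes "finite (carrier G)"
  shows "finite (S_classes G)"
proof -
  have "S_classes G \<subseteq> conj_class G ` carrier G" by (auto simp: S_classes_def)
  then show ?thesis using assms finite_subset by blast
qed

lemma K_group_iso:
  assumes fin: "finite (carrier G)"
  shows "\<exists>n \<le> card (S_classes G). K_group G \<cong> Z2_power n"
proof -
  let ?A = "abelianization G" and ?D = "derived G (carrier G)"
  interpret D: normal ?D G using derived_self_is_normal .
  interpret A: comm_group ?A
    using derived_quot_is_comm_group by (simp add: abelianization_def)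
  let ?M = "M_cosets G - {\<one>\<^bsub>?A\<^esub>}"
  have M: "M_cosets G \<subseteq> carrier ?A" by (auto simp: M_cosets_def)
  have "?M \<subseteq> (\<lambda>c. \<Union>x\<in>c. ?D #> x) ` S_classes G"
  proof
    fix C assume C: "C \<in> ?M"
    then obtain x where x: "x \<in> carrier G" "conj_class G (inv x) = conj_class G x" "conj_class G x \<subseteq> C"
      unfolding M_cosets_def by auto
    obtain y where y: "y \<in> carrier G" "C = ?D #> y"
      using C by (auto simp: M_cosets_def abelianization_def FactGroup_def RCOSETS_def)
    have *: "?D #> z = C" if "z \<in> conj_class G x" for z
      using that x y repr_independence D.subgroup_axioms by blast
    have "x \<noteq> \<one>"
    proof
      assume "x = \<one>"
      then have "C = ?D" using *[OF conj_class_self[OF x(1)]] D.subset by auto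
      then show False using C by (simp add: abelianization_def FactGroup_def)
    qed
    then have "conj_class G x \<in> S_classes G" using x by (auto simp: S_classes_def)
    moreover have "(\<Union>z\<in>conj_class G x. ?D #> z) = C" using * conj_class_self[OF x(1)] by blast
    ultimately show "C \<in> (\<lambda>c. \<Union>x\<in>c. ?D #> x) ` S_classes G" by blast
  qed
  then have "finite ?M" "card ?M \<le> card (S_classes G)"
    using finite_S_classes[OF fin] by (meson finite_imageI finite_subset, meson surj_card_le)
  moreover obtain n f where "n \<le> card ?M" and f: "f \<in> iso (Z2_power n) (?A\<lparr>carrier := generate ?A ?M\<rparr>)"
    using A.generate_involutions_iso[OF \<open>finite ?M\<close>] M M_cosets_square by blast
  moreover have "generate ?A ?M = generate ?A (carrier ?A \<inter> M_cosets G)"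
  proof
    show "generate ?A ?M \<subseteq> generate ?A (carrier ?A \<inter> M_cosets G)"
      using M by (intro A.mono_generate) auto
    have "subgroup (generate ?A ?M) ?A" using M by (intro A.generate_is_subgroup) auto
    moreover have "carrier ?A \<inter> M_cosets G \<subseteq> generate ?A ?M"
      using generate.incl[of _ ?M ?A] generate.one[of ?A ?M] by blast
    ultimately show "generate ?A (carrier ?A \<inter> M_cosets G) \<subseteq> generate ?A ?M"
      by (rule A.generate_subgroup_incl[rotated])
  qed
  ultimately have "n \<le> card (S_classes G)" "Z2_power n \<cong> K_group G"
    by (auto simp: K_group_def subgroup_generated_def intro: is_isoI)
  then show ?thesis using group.iso_sym[OF group_Z2_power] by blast
qed

lemma K_rank:
  assumes "finite (carrier G)"
  shows "K_group G \<cong> Z2_power (K_rank G)" "K_rank G \<le> card (S_classes G)"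
proof -
  obtain n where n: "n \<le> card (S_classes G)" "K_group G \<cong> Z2_power n"
    using K_group_iso[OF assms] by blast
  have "m = n" if "K_group G \<cong> Z2_power m" for m
    using iso_same_card[OF that] iso_same_card[OF n(2)] by (simp add: card_Z2_power)
  then have "K_rank G = n"
    unfolding K_rank_def using n(2) by blast
  then show "K_group G \<cong> Z2_power (K_rank G)" "K_rank G \<le> card (S_classes G)"
    using n by auto
qed

end

end

theory Submission
  imports Defs "HOL-Algebra.Multiplicative_Group"
begin

text \<open>
  Sending a tuple to the numbers \<open>count s c - count s (c\<^sup>-\<^sup>1)\<close>, for \<open>c \<in> Tp\<close>, gives homomorphisms
  from the group of singular orbit data to the integers. They are independent, because a nontrivial
  class repeated \<open>order G\<close> times is an orbit tuple; hence the group is a free abelian group of rank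
  \<open>card Tp\<close> times their common kernel. Every element of that kernel is represented by exactly one
  set of real classes, so the kernel has exponent two and is isomorphic to the kernel of the
  homomorphism that takes a set of real classes, under symmetric difference, to the product of
  its cosets in the abelianization. The image of this homomorphism is \<open>K_group G\<close>, so counting gives
  the exponent \<open>card (S_classes G) - K_rank G\<close>.
\<close>

section \<open>Splitting off free factors along homomorphisms to the integers\<close>

lemma hom_integer_kernel_subgroup:
  assumes "group K" "p \<in> hom K integer_group"
  shows "subgroup {x \<in> carrier K. p x = 0} K"
proof -
  interpret group_hom K integer_group p
    using assms by (simp add: group_hom_def group_hom_axioms_def)
  show ?thesis using subgroup_kernel by (simp add: kernel_def)
qed

text \<open>The image of \<open>p\<close> is a nonzero subgroup of the integers, hence generated by
  its least positive member \<open>d\<close>. An element \<open>b\<close> with value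
  \<open>d\<close> has powers that hit each value exactly once, so it spans a complement of the
  kernel.\<close>

lemma comm_group_iso_integer_kernel:
  assumes "comm_group K" and p: "p \<in> hom K integer_group"
    and nz: "\<exists>x \<in> carrier K. p x \<noteq> 0"
  shows "K \<cong> integer_group \<times>\<times> K\<lparr>carrier := {x \<in> carrier K. p x = 0}\<rparr>"
proof -
  interpret K: comm_group K by fact
  interpret p: group_hom K integer_group p
    using p by (simp add: group_hom_def group_hom_axioms_def)
  let ?H = "{x \<in> carrier K. p x = 0}"
  have p_pow: "p (x [^]\<^bsub>K\<^esub> k) = k * p x" if "x \<in> carrier K" for x and k :: int
    using that by (simp add: p.hom_int_pow)
  have p_mult: "p (x \<otimes>\<^bsub>K\<^esub> y) = p x + p y" if "x \<in> carrier K" "y \<in> carrier K" for x y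
    using that by simp
  have p_inv: "p (inv\<^bsub>K\<^esub> x) = - p x" if "x \<in> carrier K" for x
    using that by simp
  \<comment> \<open>The positive values of \<open>p\<close>, taken as natural numbers so that a
    least one exists. An element with a negative value is replaced by its inverse.\<close>
  define Q where "Q d \<longleftrightarrow> 0 < d \<and> (\<exists>b \<in> carrier K. p b = int d)" for d :: nat
  have "\<exists>d. Q d"
  proof -
    obtain x where x: "x \<in> carrier K" "p x \<noteq> 0" using nz by blast
    show ?thesis
    proof (cases "p x > 0")
      case True
      then show ?thesis using x unfolding Q_def by (intro exI[of _ "nat (p x)"]) auto
    next
      case False
      then show ?thesis using x p_inv[OF x(1)] unfolding Q_def
        by (intro exI[of _ "nat (- p x)"]) (auto intro!: bexI[of _ "inv\<^bsub>K\<^esub> x"])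
    qed
  qed
  define d where "d = (LEAST d. Q d)"
  have "Q d" unfolding d_def using \<open>\<exists>d. Q d\<close> by (rule LeastI_ex)
  then obtain b where d: "0 < d" and b: "b \<in> carrier K" "p b = int d"
    unfolding Q_def by auto
  have dvd: "int d dvd p y" if y: "y \<in> carrier K" for y
  proof (rule ccontr)
    assume n: "\<not> int d dvd p y"
    \<comment> \<open>The remainder modulo \<open>d\<close> is again a value of \<open>p\<close>,
      taken at \<open>?z\<close>. If it were nonzero, it would be a positive value below the least
      one.\<close>
    let ?r = "p y mod int d"
    let ?z = "y \<otimes>\<^bsub>K\<^esub> b [^]\<^bsub>K\<^esub> (- (p y div int d))"
    have "p ?z = ?r"
    proof -
      have "p ?z = p y - int d * (p y div int d)"
        using y b by (simp add: p_mult p_pow)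
      then show ?thesis by (simp add: minus_mult_div_eq_mod)
    qed
    moreover have "?r \<noteq> 0" "0 \<le> ?r" "?r < int d"
      using n d by (simp_all add: dvd_eq_mod_eq_0)
    moreover have "?z \<in> carrier K" using y b(1) by simp
    ultimately have "Q (nat ?r)" "nat ?r < d"
      unfolding Q_def by (metis int_nat_eq less_le nat_0_iff not_le zero_less_nat_eq, linarith)
    then show False using not_less_Least unfolding d_def by blast
  qed
  define f where "f = (\<lambda>(k :: int, x). b [^]\<^bsub>K\<^esub> k \<otimes>\<^bsub>K\<^esub> x)"
  have pf: "p (f (k, x)) = k * int d" if "x \<in> ?H" for k x
    using that b by (simp add: f_def p_mult p_pow)
  have "f \<in> hom (integer_group \<times>\<times> K\<lparr>carrier := ?H\<rparr>) K"
    using b by (intro homI) (auto simp: f_def K.int_pow_mult K.m_ac)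
  moreover have "inj_on f (UNIV \<times> ?H)"
  proof (rule inj_onI, clarify)
    fix k l x y assume xy: "x \<in> carrier K" "y \<in> carrier K" "p x = 0" "p y = 0"
      and eq: "f (k, x) = f (l, y)"
    then have "k = l" using pf[of x k] pf[of y l] d by simp
    then show "k = l \<and> x = y" using eq xy b by (simp add: f_def)
  qed
  moreover have "carrier K \<subseteq> f ` (UNIV \<times> ?H)"
  proof
    fix y assume y: "y \<in> carrier K"
    obtain k where k: "p y = int d * k" using dvd[OF y] by (auto elim: dvdE)
    \<comment> \<open>Dividing \<open>y\<close> by the power of \<open>b\<close> with the same value
      leaves an element of the kernel.\<close>
    let ?x = "b [^]\<^bsub>K\<^esub> (- k) \<otimes>\<^bsub>K\<^esub> y"
    have "?x \<in> ?H" using y b k by (simp add: p_mult p_pow mult.commute)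
    moreover have "f (k, ?x) = y"
      using y b by (simp add: f_def K.int_pow_mult[symmetric] K.m_assoc[symmetric])
    ultimately show "y \<in> f ` (UNIV \<times> ?H)" by (metis (no_types, lifting) SigmaI UNIV_I image_eqI)
  qed
  ultimately have "f \<in> iso (integer_group \<times>\<times> K\<lparr>carrier := ?H\<rparr>) K"
    unfolding iso_iff by (auto simp: hom_def)
  moreover have "group (integer_group \<times>\<times> K\<lparr>carrier := ?H\<rparr>)"
    using K.subgroup_imp_group[OF hom_integer_kernel_subgroup[OF K.group_axioms p]]
    by (intro DirProd_group) simp
  ultimately show ?thesis using group.iso_sym is_isoI by blast
qed

lemma carrier_free_abelian_power:
  "x \<in> carrier (free_abelian_power n) \<longleftrightarrow> (\<forall>i\<ge>n. x i = undefined)"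
proof -
  have "carrier (free_abelian_power n) = extensional {..<n}"
    by (simp add: free_abelian_power_def PiE_def)
  then show ?thesis by (simp add: extensional_def not_less)
qed

lemma mult_free_abelian_power:
  "(x \<otimes>\<^bsub>free_abelian_power n\<^esub> y) i = (if i < n then x i + y i else undefined)"
  by (simp add: free_abelian_power_def)

lemma free_abelian_power_Suc:
  "integer_group \<times>\<times> free_abelian_power n \<cong> free_abelian_power (Suc n)"
proof (rule is_isoI)
  let ?P = "integer_group \<times>\<times> free_abelian_power n" and ?F = "free_abelian_power (Suc n)"
  \<comment> \<open>The integer factor becomes the new last coordinate, at index
    \<open>n\<close>.\<close>
  let ?f = "\<lambda>z :: int \<times> (nat \<Rightarrow> int). (snd z)(n := fst z)"
  have car: "z \<in> carrier ?P \<longleftrightarrow> (\<forall>i\<ge>n. snd z i = undefined)" for z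
    by (cases z) (simp add: carrier_free_abelian_power)
  have fin: "?f z \<in> carrier ?F" if "z \<in> carrier ?P" for z
    unfolding carrier_free_abelian_power
  proof (intro allI impI)
    fix i assume "Suc n \<le> i"
    then show "?f z i = undefined" using that[unfolded car, rule_format, of i] by simp
  qed
  have "?f (z \<otimes>\<^bsub>?P\<^esub> w) i = (?f z \<otimes>\<^bsub>?F\<^esub> ?f w) i" for z w i
    by (cases z; cases w; cases "i = n") (simp_all add: mult_free_abelian_power)
  then have hom: "?f (z \<otimes>\<^bsub>?P\<^esub> w) = ?f z \<otimes>\<^bsub>?F\<^esub> ?f w" for z w
    by (rule ext)
  have "z = w" if "z \<in> carrier ?P" "w \<in> carrier ?P" and eq: "?f z = ?f w" for z w
  proof (rule prod_eqI)
    show "fst z = fst w" using fun_cong[OF eq, of n] by simp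
    have "snd z i = snd w i" for i
      using fun_cong[OF eq, of i] that(1,2)[unfolded car, rule_format, of i]
      by (cases "i = n") simp_all
    then show "snd z = snd w" by (rule ext)
  qed
  then have inj: "inj_on ?f (carrier ?P)" by (intro inj_onI)
  have "x \<in> ?f ` carrier ?P" if x: "x \<in> carrier ?F" for x
  proof
    \<comment> \<open>Members of \<open>free_abelian_power n\<close> are \<open>undefined\<close>
      from index \<open>n\<close> on, so the split-off coordinate has to be reset to that
      value.\<close>
    let ?z = "(x n, x(n := undefined))"
    show "x = ?f ?z" by simp
    have "(x(n := undefined)) i = undefined" if "n \<le> i" for i
      using x[unfolded carrier_free_abelian_power, rule_format, of i] that
      by (cases "i = n") simp_all
    then show "?z \<in> carrier ?P" unfolding car by simp
  qed
  then show "?f \<in> iso ?P ?F"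
    unfolding iso_iff using fin hom inj by (intro conjI homI) blast+
qed

lemma free_abelian_power_0: "group K \<Longrightarrow> K \<cong> free_abelian_power 0 \<times>\<times> K"
  by (rule is_isoI[of "\<lambda>x. (\<lambda>_. undefined, x)"])
    (auto simp: iso_iff hom_def free_abelian_power_def inj_on_def)

text \<open>Induction that splits off \<open>p n\<close> and continues inside its kernel, for which
  \<open>K\<close> has to be arbitrary. The witness for each \<open>i < n\<close> is killed by all
  other homomorphisms, in particular by \<open>p n\<close>. It therefore lies in that kernel and
  remains a witness there.\<close>

lemma comm_group_iso_free_kernel:
  assumes "comm_group K" and "\<And>i. i < n \<Longrightarrow> p i \<in> hom K integer_group"
    and "\<And>i. i < n \<Longrightarrow> \<exists>x \<in> carrier K. p i x \<noteq> 0 \<and> (\<forall>j<n. j \<noteq> i \<longrightarrow> p j x = 0)"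
  shows "K \<cong> free_abelian_power n \<times>\<times> K\<lparr>carrier := {x \<in> carrier K. \<forall>i<n. p i x = 0}\<rparr>"
  using assms
proof (induction n arbitrary: K)
  case 0
  then show ?case using free_abelian_power_0[of K] by (simp add: comm_group_def)
next
  case (Suc n)
  interpret K: comm_group K by fact
  let ?H = "{x \<in> carrier K. p n x = 0}"
  let ?K = "K\<lparr>carrier := ?H\<rparr>"
  let ?R = "K\<lparr>carrier := {x \<in> carrier K. \<forall>i<Suc n. p i x = 0}\<rparr>"
  have sub: "subgroup ?H K"
    using Suc.prems by (intro hom_integer_kernel_subgroup) auto
  have comm: "comm_group ?K"
    using group.group_comm_groupI[OF K.subgroup_imp_group[OF sub]] K.m_comm by simp
  \<comment> \<open>Iterated kernels agree with the common kernel, since only the last carrier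
    update counts.\<close>
  have R: "?K\<lparr>carrier := {x \<in> carrier ?K. \<forall>i<n. p i x = 0}\<rparr> = ?R"
  proof -
    have "K\<lparr>carrier := A, carrier := B\<rparr> = K\<lparr>carrier := B\<rparr>" for A B by simp
    moreover have "{x \<in> carrier ?K. \<forall>i<n. p i x = 0} = {x \<in> carrier K. \<forall>i<Suc n. p i x = 0}"
      by (auto simp: less_Suc_eq)
    ultimately show ?thesis by metis
  qed
  have "?K \<cong> free_abelian_power n \<times>\<times> ?K\<lparr>carrier := {x \<in> carrier ?K. \<forall>i<n. p i x = 0}\<rparr>"
  proof (rule Suc.IH[OF comm])
    fix i assume i: "i < n"
    show "p i \<in> hom ?K integer_group"
      using Suc.prems(2)[of i] i by (auto simp: hom_def)
    obtain x where "x \<in> carrier K" "p i x \<noteq> 0" "\<forall>j<Suc n. j \<noteq> i \<longrightarrow> p j x = 0"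
      using Suc.prems(3)[of i] i by auto
    then show "\<exists>x\<in>carrier ?K. p i x \<noteq> 0 \<and> (\<forall>j<n. j \<noteq> i \<longrightarrow> p j x = 0)"
      using i by (intro bexI[of _ x]) auto
  qed
  then have IH: "?K \<cong> free_abelian_power n \<times>\<times> ?R" unfolding R .
  have F: "group (free_abelian_power m)" for m by (simp add: free_abelian_power_def)
  have "K \<cong> integer_group \<times>\<times> ?K"
    using Suc.prems(2)[of n] Suc.prems(3)[of n] comm_group_iso_integer_kernel[OF K.comm_group_axioms]
    by blast
  also have "integer_group \<times>\<times> ?K \<cong> integer_group \<times>\<times> (free_abelian_power n \<times>\<times> ?R)"
    by (rule group.DirProd_iso_trans[OF group_integer_group iso_refl IH])
  also have "\<dots> \<cong> (integer_group \<times>\<times> free_abelian_power n) \<times>\<times> ?R"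
    by (rule is_isoI[of "\<lambda>(x, y, z). ((x, y), z)"]) (auto simp: iso_iff hom_def inj_on_def image_def)
  also have "\<dots> \<cong> free_abelian_power (Suc n) \<times>\<times> ?R"
    by (intro group.DirProd_iso_trans free_abelian_power_Suc iso_refl DirProd_group F
        group_integer_group)
  finally show ?case .
qed

section \<open>Groups of exponent two and counting by the first isomorphism theorem\<close>

text \<open>Such an \<open>H\<close> is generated by a finite set of involutions and the identity,
  namely by itself, so \<open>generate_involutions_iso\<close> applies.\<close>

lemma (in comm_group) exponent_two_iso_Z2_power:
  assumes "finite H" and H: "subgroup H G" and "\<And>a. a \<in> H \<Longrightarrow> a \<otimes> a = \<one>"
  shows "\<exists>n. G\<lparr>carrier := H\<rparr> \<cong> Z2_power n"
proof -
  interpret H: subgroup H G by fact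
  have "generate G H = H"
    using H by (auto intro: generate.incl dest: generate_subgroup_incl[OF subset_refl, THEN subsetD])
  then obtain n f where "f \<in> iso (Z2_power n) (G\<lparr>carrier := H\<rparr>)"
    using generate_involutions_iso[OF assms(1) H.subset assms(3)] by auto
  then show ?thesis using group.iso_sym[OF group_Z2_power is_isoI] by blast
qed

lemma (in group_hom) card_kernel_image:
  assumes "finite (carrier G)"
  shows "card (h ` carrier G) * card (kernel G H h) = card (carrier G)"
proof -
  let ?f = "\<lambda>X. the_elem (h ` X)"
  \<comment> \<open>The first isomorphism theorem is applied to a surjective map, so the codomain is
    cut down to the image. Lagrange's theorem then turns the index of the kernel into the
    count.\<close>
  interpret I: group_hom G "H\<lparr>carrier := h ` carrier G\<rparr>" h
  proof -
    have "group (H\<lparr>carrier := h ` carrier G\<rparr>)"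
      using img_is_subgroup by (rule H.subgroup_imp_group)
    then show "group_hom G (H\<lparr>carrier := h ` carrier G\<rparr>) h"
      by (auto simp: group_hom_def group_hom_axioms_def hom_def)
  qed
  have "kernel G (H\<lparr>carrier := h ` carrier G\<rparr>) h = kernel G H h" by (simp add: kernel_def)
  then have "G Mod kernel G H h \<cong> H\<lparr>carrier := h ` carrier G\<rparr>"
    using I.FactGroup_iso by simp
  then have "card (rcosets kernel G H h) = card (h ` carrier G)"
    using iso_same_card by (fastforce simp: FactGroup_def)
  then show ?thesis using G.lagrange[OF subgroup_kernel] by (simp add: order_def)
qed

section \<open>Conjugacy classes, their inverses and their cosets in the abelianization\<close>

definition class_inv :: "('a, 'b) monoid_scheme \<Rightarrow> 'a set \<Rightarrow> 'a set" where
  "class_inv G c = m_inv G ` c"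

text \<open>A union over all members avoids choosing a representative. For a conjugacy class it is a
  single coset, by \<open>class_coset_conj_class\<close>.\<close>

definition class_coset :: "('a, 'b) monoid_scheme \<Rightarrow> 'a set \<Rightarrow> 'a set" where
  "class_coset G c = (\<Union>x\<in>c. derived G (carrier G) #>\<^bsub>G\<^esub> x)"

definition nontrivial_classes :: "('a, 'b) monoid_scheme \<Rightarrow> 'a set set" where
  "nontrivial_classes G = conj_class G ` (carrier G - {\<one>\<^bsub>G\<^esub>})"

text \<open>With the multiplicities as exponents and a fixed index set, additivity in
  \<open>s\<close> becomes the product rule for \<open>finprod\<close>.\<close>

definition tuple_coset :: "('a, 'b) monoid_scheme \<Rightarrow> 'a set multiset \<Rightarrow> 'a set" where
  "tuple_coset G s = (\<Otimes>\<^bsub>abelianization G\<^esub>c \<in> nontrivial_classes G.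
     class_coset G c [^]\<^bsub>abelianization G\<^esub> count s c)"

context group
begin

lemma comm_group_abelianization: "comm_group (abelianization G)"
  unfolding abelianization_def by (rule derived_quot_is_comm_group)

lemma one_abelianization: "\<one>\<^bsub>abelianization G\<^esub> = derived G (carrier G)"
  by (simp add: abelianization_def FactGroup_def)

lemma hom_abelianization: "(\<lambda>x. derived G (carrier G) #> x) \<in> hom G (abelianization G)"
  unfolding abelianization_def by (rule normal.r_coset_hom_Mod[OF derived_self_is_normal])

lemma coset_eq_derived_iff:
  assumes "x \<in> carrier G"
  shows "derived G (carrier G) #> x = derived G (carrier G) \<longleftrightarrow> x \<in> derived G (carrier G)"
  using rcos_self[OF assms subgroup_derived] coset_join2[OF assms subgroup_derived] by auto

lemma conj_class_one: "conj_class G \<one> = {\<one>}"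
  using conj_class_self[of \<one>] by (auto simp: conj_class_eq)

lemma conj_class_eq_one_iff: "x \<in> carrier G \<Longrightarrow> conj_class G x = conj_class G \<one> \<longleftrightarrow> x = \<one>"
  using conj_class_self[of x] by (auto simp: conj_class_one)

lemma class_inv_conj_class:
  assumes x: "x \<in> carrier G"
  shows "class_inv G (conj_class G x) = conj_class G (inv x)"
proof -
  have "inv (g \<otimes> x \<otimes> inv g) = g \<otimes> inv x \<otimes> inv g" if "g \<in> carrier G" for g
    using x that by (simp add: inv_mult_group m_assoc)
  then show ?thesis using x by (auto simp: class_inv_def conj_class_eq image_def)
qed

text \<open>Conjugation by \<open>g\<close> is trivial in the commutative quotient, so all members
  of the class have the coset of \<open>x\<close>.\<close>

lemma class_coset_conj_class:
  assumes x: "x \<in> carrier G"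
  shows "class_coset G (conj_class G x) = derived G (carrier G) #> x"
proof -
  let ?A = "abelianization G" and ?q = "\<lambda>x. derived G (carrier G) #> x"
  interpret A: comm_group ?A by (rule comm_group_abelianization)
  interpret q: group_hom G ?A ?q
    using hom_abelianization by (simp add: group_hom_def group_hom_axioms_def A.group_axioms)
  have "?q (g \<otimes> x \<otimes> inv g) = ?q x" if g: "g \<in> carrier G" for g
  proof -
    have "?q (g \<otimes> x \<otimes> inv g) = (?q g \<otimes>\<^bsub>?A\<^esub> ?q x) \<otimes>\<^bsub>?A\<^esub> inv\<^bsub>?A\<^esub> ?q g"
      using x g by (simp only: q.hom_mult q.hom_inv m_closed inv_closed)
    also have "\<dots> = ?q x"
      using q.hom_closed[OF x] q.hom_closed[OF g] by (simp add: A.m_comm[of "?q g" "?q x"] A.m_assoc)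
    finally show ?thesis .
  qed
  then show ?thesis
    using x conj_class_self[OF x] by (auto simp: class_coset_def conj_class_eq)
qed

lemma nontrivial_classesE:
  assumes "c \<in> nontrivial_classes G"
  obtains x where "x \<in> carrier G" "x \<noteq> \<one>" "c = conj_class G x"
  using assms by (auto simp: nontrivial_classes_def)

lemma conj_class_nontrivial:
  "x \<in> carrier G \<Longrightarrow> conj_class G x \<in> nontrivial_classes G \<longleftrightarrow> x \<noteq> \<one>"
  using conj_class_eq_one_iff by (auto simp: nontrivial_classes_def)

lemma class_inv_nontrivial: "c \<in> nontrivial_classes G \<Longrightarrow> class_inv G c \<in> nontrivial_classes G"
  by (auto elim!: nontrivial_classesE simp: class_inv_conj_class conj_class_nontrivial)

lemma class_inv_class_inv: "c \<in> nontrivial_classes G \<Longrightarrow> class_inv G (class_inv G c) = c"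
  by (auto elim!: nontrivial_classesE simp: class_inv_conj_class)

lemma class_coset_closed:
  "c \<in> nontrivial_classes G \<Longrightarrow> class_coset G c \<in> carrier (abelianization G)"
  using hom_in_carrier[OF hom_abelianization]
  by (auto elim!: nontrivial_classesE simp: class_coset_conj_class)

lemma finite_nontrivial_classes: "finite (carrier G) \<Longrightarrow> finite (nontrivial_classes G)"
  by (simp add: nontrivial_classes_def)

text \<open>Together with \<open>T_classes_iff\<close> this replaces representatives by the
  involution \<open>class_inv\<close> on the nontrivial classes: its fixed points are the real
  classes.\<close>

lemma S_classes_iff: "c \<in> S_classes G \<longleftrightarrow> c \<in> nontrivial_classes G \<and> class_inv G c = c"
proof
  assume "c \<in> S_classes G"
  then obtain x where "x \<in> carrier G" "c = conj_class G x" "conj_class G (inv x) = c" "x \<noteq> \<one>"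
    by (auto simp: S_classes_def)
  then show "c \<in> nontrivial_classes G \<and> class_inv G c = c"
    by (simp add: class_inv_conj_class conj_class_nontrivial)
next
  assume "c \<in> nontrivial_classes G \<and> class_inv G c = c"
  then obtain x where "x \<in> carrier G" "c = conj_class G x" "conj_class G (inv x) = c" "x \<noteq> \<one>"
    by (metis class_inv_conj_class nontrivial_classesE)
  then show "c \<in> S_classes G" by (auto simp: S_classes_def)
qed

text \<open>The identity is its own inverse, so a class that differs from its inverse is
  automatically nontrivial.\<close>

lemma T_classes_iff: "c \<in> T_classes G \<longleftrightarrow> c \<in> nontrivial_classes G \<and> class_inv G c \<noteq> c"
proof
  assume "c \<in> T_classes G"
  then obtain x where "x \<in> carrier G" "c = conj_class G x" "conj_class G (inv x) \<noteq> c"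
    by (auto simp: T_classes_def)
  then show "c \<in> nontrivial_classes G \<and> class_inv G c \<noteq> c"
    by (auto simp: class_inv_conj_class conj_class_nontrivial)
qed (auto simp: T_classes_def class_inv_conj_class elim!: nontrivial_classesE)

text \<open>The key is that \<open>inverse_classes G Tp\<close> is the image of \<open>Tp\<close>
  under the involution \<open>class_inv\<close>. The two conditions in \<open>is_T_plus\<close> then
  say that each nonreal class has exactly one of itself and its inverse in
  \<open>Tp\<close>.\<close>

lemma T_plus_classes:
  assumes "is_T_plus G Tp"
  shows "c \<in> Tp \<Longrightarrow> c \<in> nontrivial_classes G \<and> class_inv G c \<noteq> c \<and> class_inv G c \<notin> Tp"
    and "c \<in> nontrivial_classes G \<Longrightarrow> c \<in> S_classes G \<or> c \<in> Tp \<or> class_inv G c \<in> Tp"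
proof -
  have T: "T_classes G = Tp \<union> inverse_classes G Tp" and dis: "Tp \<inter> inverse_classes G Tp = {}"
    using assms by (auto simp: is_T_plus_def)
  have inv: "inverse_classes G Tp = class_inv G ` Tp"
  proof -
    have "c \<in> conj_class G ` carrier G" if "c \<in> Tp" for c
      using that T by (auto simp: T_classes_def)
    then have Tp: "Tp \<inter> conj_class G ` carrier G = Tp" by blast
    have "inverse_classes G Tp =
        (\<lambda>x. class_inv G (conj_class G x)) ` {x \<in> carrier G. conj_class G x \<in> Tp}"
      by (auto simp: inverse_classes_def class_inv_conj_class image_iff)
    also have "\<dots> = class_inv G ` (Tp \<inter> conj_class G ` carrier G)" by blast
    finally show ?thesis unfolding Tp .
  qed
  have mem: "c \<in> nontrivial_classes G \<and> class_inv G c \<noteq> c \<longleftrightarrow> c \<in> Tp \<or> c \<in> class_inv G ` Tp" for c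
    using T_classes_iff[of c] unfolding T inv by simp
  have Tp: "c \<in> nontrivial_classes G \<and> class_inv G c \<noteq> c" if "c \<in> Tp" for c
    using mem[of c] that by simp
  show "c \<in> nontrivial_classes G \<and> class_inv G c \<noteq> c \<and> class_inv G c \<notin> Tp" if c: "c \<in> Tp"
    using Tp[OF c] dis[unfolded inv] c by auto
  show "c \<in> S_classes G \<or> c \<in> Tp \<or> class_inv G c \<in> Tp" if c: "c \<in> nontrivial_classes G"
  proof (cases "class_inv G c = c")
    case True
    then show ?thesis using c S_classes_iff by simp
  next
    case False
    then consider "c \<in> Tp" | d where "d \<in> Tp" "c = class_inv G d"
      using mem[of c] c by auto
    then show ?thesis using Tp class_inv_class_inv by cases auto
  qed
qed

section \<open>Orbit tuples and cancelling tuples described by multiplicities\<close>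

lemma class_tuple_Cons:
  "class_tuple G (x # xs) = (if x = \<one> then {#} else {#conj_class G x#}) + class_tuple G xs"
  by (simp add: class_tuple_def)

lemma set_class_tuple:
  "set xs \<subseteq> carrier G \<Longrightarrow> set_mset (class_tuple G xs) \<subseteq> nontrivial_classes G"
  by (auto simp: class_tuple_def nontrivial_classes_def)

lemma set_mset_nontrivialE:
  assumes "set_mset s \<subseteq> nontrivial_classes G"
  obtains xs where "set xs \<subseteq> carrier G" "s = class_tuple G xs"
proof -
  have "\<exists>xs. set xs \<subseteq> carrier G \<and> s = class_tuple G xs"
    using assms
  proof (induction s)
    case empty
    then show ?case by (intro exI[of _ "[]"]) (simp add: class_tuple_Nil)
  next
    case (add c s)
    then obtain xs x where "set xs \<subseteq> carrier G" "s = class_tuple G xs"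
      "x \<in> carrier G" "x \<noteq> \<one>" "c = conj_class G x" by (auto elim!: nontrivial_classesE)
    then show ?case by (intro exI[of _ "x # xs"]) (simp add: class_tuple_Cons)
  qed
  then show ?thesis using that by blast
qed

lemma tuple_coset_closed: "tuple_coset G s \<in> carrier (abelianization G)"
proof -
  interpret A: comm_group "abelianization G" by (rule comm_group_abelianization)
  show ?thesis unfolding tuple_coset_def by (rule A.finprod_closed) (simp add: class_coset_closed)
qed

lemma tuple_coset_add:
  "tuple_coset G (s + t) = tuple_coset G s \<otimes>\<^bsub>abelianization G\<^esub> tuple_coset G t"
proof -
  interpret A: comm_group "abelianization G" by (rule comm_group_abelianization)
  have "tuple_coset G (s + t) = (\<Otimes>\<^bsub>abelianization G\<^esub>c \<in> nontrivial_classes G.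
     class_coset G c [^]\<^bsub>abelianization G\<^esub> count s c
     \<otimes>\<^bsub>abelianization G\<^esub> class_coset G c [^]\<^bsub>abelianization G\<^esub> count t c)"
    unfolding tuple_coset_def by (rule A.finprod_cong') (auto simp: A.nat_pow_mult class_coset_closed)
  also have "\<dots> = tuple_coset G s \<otimes>\<^bsub>abelianization G\<^esub> tuple_coset G t"
    unfolding tuple_coset_def by (rule A.finprod_multf) (auto simp: class_coset_closed)
  finally show ?thesis .
qed

lemma tuple_coset_empty: "tuple_coset G {#} = \<one>\<^bsub>abelianization G\<^esub>"
proof -
  interpret A: comm_group "abelianization G" by (rule comm_group_abelianization)
  show ?thesis by (simp add: tuple_coset_def)
qed

lemma tuple_coset_single:
  assumes "finite (carrier G)" and c: "c \<in> nontrivial_classes G"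
  shows "tuple_coset G {#c#} = class_coset G c"
proof -
  let ?A = "abelianization G"
  interpret A: comm_group ?A by (rule comm_group_abelianization)
  have "tuple_coset G {#c#} = (\<Otimes>\<^bsub>?A\<^esub>d \<in> nontrivial_classes G.
      if c = d then class_coset G d else \<one>\<^bsub>?A\<^esub>)"
    unfolding tuple_coset_def by (rule A.finprod_cong') (auto simp: class_coset_closed)
  also have "\<dots> = class_coset G c"
    using c by (rule A.finprod_singleton)
      (auto simp: class_coset_closed finite_nontrivial_classes assms)
  finally show ?thesis .
qed

text \<open>The projection to the abelianization is a homomorphism, so it carries the product of the
  list to the product of the cosets. An identity deleted from the tuple contributes only the trivial
  coset.\<close>

lemma tuple_coset_class_tuple:
  assumes fin: "finite (carrier G)" and "set xs \<subseteq> carrier G"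
  shows "tuple_coset G (class_tuple G xs) = derived G (carrier G) #> foldr (\<otimes>) xs \<one>"
  using assms(2)
proof (induction xs)
  case Nil
  then show ?case using coset_eq_derived_iff[of \<one>] subgroup.one_closed[OF subgroup_derived]
    by (simp add: class_tuple_Nil tuple_coset_empty one_abelianization)
next
  case (Cons x xs)
  let ?A = "abelianization G" and ?q = "\<lambda>x. derived G (carrier G) #> x"
  interpret A: comm_group ?A by (rule comm_group_abelianization)
  interpret q: group_hom G ?A ?q
    using hom_abelianization by (simp add: group_hom_def group_hom_axioms_def A.group_axioms)
  have x: "x \<in> carrier G" using Cons.prems by simp
  have "tuple_coset G (if x = \<one> then {#} else {#conj_class G x#}) = ?q x"
  proof (cases "x = \<one>")
    case True
    then show ?thesis using q.hom_one by (simp add: tuple_coset_empty)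
  next
    case False
    then have c: "conj_class G x \<in> nontrivial_classes G" using x by (simp add: conj_class_nontrivial)
    then show ?thesis using False x fin by (simp add: tuple_coset_single class_coset_conj_class)
  qed
  moreover have "?q (x \<otimes> foldr (\<otimes>) xs \<one>) = ?q x \<otimes>\<^bsub>?A\<^esub> ?q (foldr (\<otimes>) xs \<one>)"
    using x Cons.prems by (intro q.hom_mult) (auto intro: foldr_mult_closed)
  ultimately show ?case using Cons by (simp add: class_tuple_Cons tuple_coset_add)
qed

lemma tuple_coset_eq_one_iff:
  assumes "finite (carrier G)" "set xs \<subseteq> carrier G"
  shows "tuple_coset G (class_tuple G xs) = \<one>\<^bsub>abelianization G\<^esub> \<longleftrightarrow>
    foldr (\<otimes>) xs \<one> \<in> derived G (carrier G)"
  unfolding tuple_coset_class_tuple[OF assms] one_abelianization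
  by (rule coset_eq_derived_iff[OF foldr_mult_closed[OF assms(2)]])

text \<open>Turns the condition on some list of representatives into one on the multiset itself.
  This is the independence of order and representatives.\<close>

lemma orbit_tuples_iff:
  assumes "finite (carrier G)"
  shows "s \<in> orbit_tuples G \<longleftrightarrow>
    set_mset s \<subseteq> nontrivial_classes G \<and> tuple_coset G s = \<one>\<^bsub>abelianization G\<^esub>"
proof
  assume "s \<in> orbit_tuples G"
  then obtain xs where "s = class_tuple G xs" "set xs \<subseteq> carrier G"
    "foldr (\<otimes>) xs \<one> \<in> derived G (carrier G)" unfolding orbit_tuples_def by blast
  then show "set_mset s \<subseteq> nontrivial_classes G \<and> tuple_coset G s = \<one>\<^bsub>abelianization G\<^esub>"
    using tuple_coset_eq_one_iff[OF assms] set_class_tuple by blast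
next
  assume s: "set_mset s \<subseteq> nontrivial_classes G \<and> tuple_coset G s = \<one>\<^bsub>abelianization G\<^esub>"
  then obtain xs where "set xs \<subseteq> carrier G" "s = class_tuple G xs"
    using set_mset_nontrivialE by blast
  then show "s \<in> orbit_tuples G"
    using s tuple_coset_eq_one_iff[OF assms] unfolding orbit_tuples_def by blast
qed

lemma cancelling_pairs_eq:
  "cancelling_pairs G = insert {#} ((\<lambda>c. {#c, class_inv G c#}) ` nontrivial_classes G)"
proof -
  have pair: "class_tuple G [x, inv x] =
      (if x = \<one> then {#} else {#conj_class G x, class_inv G (conj_class G x)#})"
    if "x \<in> carrier G" for x
    using that by (simp add: class_tuple_def class_inv_conj_class)
  have "cancelling_pairs G = (\<lambda>x. class_tuple G [x, inv x]) ` carrier G"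
    by (auto simp: cancelling_pairs_def)
  \<comment> \<open>The identity yields the empty tuple, all other elements a genuine pair.\<close>
  also have "carrier G = insert \<one> (carrier G - {\<one>})" by auto
  also have "(\<lambda>x. class_tuple G [x, inv x]) ` \<dots> =
      insert {#} ((\<lambda>x. {#conj_class G x, class_inv G (conj_class G x)#}) ` (carrier G - {\<one>}))"
    unfolding image_insert using pair[OF one_closed] pair
    by (intro arg_cong2[where f = insert] image_cong) simp_all
  finally show ?thesis by (simp only: nontrivial_classes_def image_image)
qed

text \<open>Each pair satisfies the symmetry and parity conditions, and both are preserved by sums.
  Conversely, a nonempty multiset satisfying them contains a whole pair. Removing it preserves the
  conditions, so induction on the size applies.\<close>

lemma cancelling_tuples_iff:
  "b \<in> cancelling_tuples G \<longleftrightarrow> set_mset b \<subseteq> nontrivial_classes G \<and>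
    (\<forall>c \<in> nontrivial_classes G. count b (class_inv G c) = count b c) \<and>
    (\<forall>c \<in> S_classes G. even (count b c))" (is "_ \<longleftrightarrow> ?P b")
proof
  assume "b \<in> cancelling_tuples G"
  then obtain P where b: "b = \<Sum>\<^sub># P" and P: "set_mset P \<subseteq> cancelling_pairs G"
    by (auto simp: cancelling_tuples_def)
  have "?P (\<Sum>\<^sub># P)" using P
  proof (induction P)
    case (add a P)
    then have IH: "?P (\<Sum>\<^sub># P)" and "a \<in> cancelling_pairs G" by auto
    then consider "a = {#}" | d where "d \<in> nontrivial_classes G" "a = {#d, class_inv G d#}"
      by (auto simp: cancelling_pairs_eq)
    then show ?case
    proof cases
      case 1
      then show ?thesis using IH by simp
    next
      case 2
      have "class_inv G c = d \<longleftrightarrow> c = class_inv G d" "class_inv G c = class_inv G d \<longleftrightarrow> c = d"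
        if "c \<in> nontrivial_classes G" for c
        using that 2 class_inv_class_inv by metis+
      then have "count a (class_inv G c) = count a c" if "c \<in> nontrivial_classes G" for c
        using that unfolding 2 by auto
      moreover have "even (count a c)" if "c \<in> S_classes G" for c
      proof -
        have "class_inv G d = c \<longleftrightarrow> d = c"
          using that 2 class_inv_class_inv by (metis S_classes_iff)
        then show ?thesis unfolding 2 by auto
      qed
      moreover have "set_mset a \<subseteq> nontrivial_classes G" using 2 class_inv_nontrivial by simp
      ultimately show ?thesis using IH by simp
    qed
  qed simp
  then show "?P b" by (simp add: b)
next
  assume "?P b"
  then show "b \<in> cancelling_tuples G"
  proof (induction "size b" arbitrary: b rule: less_induct)
    case less
    show ?case
    proof (cases "b = {#}")
      case True
      then show ?thesis by (simp add: cancelling_tuples_zero)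
    next
      case False
      then obtain c where c: "c \<in># b" by blast
      then have cN: "c \<in> nontrivial_classes G" using less.prems by blast
      let ?a = "{#c, class_inv G c#}"
      have ci: "count b (class_inv G c) = count b c" using less.prems cN by blast
      have "?a \<subseteq># b"
      proof (rule mset_subset_eqI)
        fix d
        \<comment> \<open>For a real class the pair is \<open>c\<close> twice. Evenness is what
          supplies the second copy.\<close>
        have "2 \<le> count b c" if "class_inv G c = c"
        proof -
          have "even (count b c)" "count b c \<noteq> 0"
            using that cN less.prems c by (auto simp: S_classes_iff)
          then show ?thesis by presburger
        qed
        moreover have "1 \<le> count b c" using c by (simp add: Suc_le_eq)
        ultimately show "count ?a d \<le> count b d" using ci
          by (cases "d = c"; cases "d = class_inv G c") simp_all
      qed
      then obtain e where e: "b = ?a + e" by (metis subset_mset.le_iff_add)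
      have "?P e"
      proof -
        have "count e (class_inv G d) = count e d" if d: "d \<in> nontrivial_classes G" for d
        proof -
          have "class_inv G d = c \<longleftrightarrow> d = class_inv G c" "class_inv G d = class_inv G c \<longleftrightarrow> d = c"
            using d cN class_inv_class_inv by metis+
          moreover have "count b (class_inv G d) = count b d" using less.prems d by blast
          ultimately show ?thesis unfolding e by (auto split: if_splits)
        qed
        moreover have "even (count e d)" if d: "d \<in> S_classes G" for d
        proof -
          have "class_inv G c = d \<longleftrightarrow> c = d"
            using d cN class_inv_class_inv by (metis S_classes_iff)
          moreover have "even (count b d)" using less.prems d by blast
          ultimately show ?thesis unfolding e by (auto split: if_splits)
        qed
        ultimately show ?thesis using less.prems unfolding e by auto
      qed
      then have "e \<in> cancelling_tuples G" using less.hyps[of e] e by simp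
      moreover have "?a \<in> cancelling_tuples G"
      proof -
        have "?a = \<Sum>\<^sub># {#?a#} \<and> set_mset {#?a#} \<subseteq> cancelling_pairs G"
          using cN by (auto simp: cancelling_pairs_eq)
        then show ?thesis unfolding cancelling_tuples_def by blast
      qed
      ultimately show ?thesis using e cancelling_tuples_add by blast
    qed
  qed
qed

end

section \<open>Difference homomorphisms, and sets of real classes under symmetric difference\<close>

text \<open>The vector space of functions from \<open>X\<close> to the field with two elements, each
  function encoded by its support.\<close>

definition sym_diff_group :: "'a set \<Rightarrow> 'a set monoid" where
  "sym_diff_group X =
    \<lparr>carrier = Pow X, monoid.mult = (\<lambda>A B. (A - B) \<union> (B - A)), one = {}\<rparr>"

lemma group_sym_diff_group: "group (sym_diff_group X)"
proof (rule groupI)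
  fix A assume "A \<in> carrier (sym_diff_group X)"
  then show "\<exists>B\<in>carrier (sym_diff_group X). B \<otimes>\<^bsub>sym_diff_group X\<^esub> A = \<one>\<^bsub>sym_diff_group X\<^esub>"
    by (intro bexI[of _ A]) (simp_all add: sym_diff_group_def)
qed (auto simp: sym_diff_group_def)

definition class_diff :: "('a, 'b) monoid_scheme \<Rightarrow> 'a set \<Rightarrow> 'a set multiset \<Rightarrow> int" where
  "class_diff G c s = int (count s c) - int (count s (class_inv G c))"

text \<open>The representative picked by \<open>SOME\<close> does not affect the value when
  \<open>c\<close> is a nontrivial class, as \<open>orbit_data_diff_class\<close> shows for members
  of the group.\<close>

definition orbit_data_diff :: "('a, 'b) monoid_scheme \<Rightarrow> 'a set \<Rightarrow> 'a set multiset set \<Rightarrow> int" where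
  "orbit_data_diff G c U = class_diff G c (SOME s. s \<in> U)"

context group
begin

lemma class_diff_add: "class_diff G c (s + t) = class_diff G c s + class_diff G c t"
  by (simp add: class_diff_def)

lemma class_diff_cancelling:
  "a \<in> cancelling_tuples G \<Longrightarrow> c \<in> nontrivial_classes G \<Longrightarrow> class_diff G c a = 0"
  by (simp add: class_diff_def cancelling_tuples_iff)

lemma carrier_singular_orbit_data:
  "carrier (singular_orbit_data G) = (\<lambda>s. orbit_rel G `` {s}) ` orbit_tuples G"
  by (auto simp: singular_orbit_data_def quotient_def)

lemma orbit_rel_classes_eq_iff:
  assumes "s \<in> orbit_tuples G" "t \<in> orbit_tuples G"
  shows "orbit_rel G `` {s} = orbit_rel G `` {t} \<longleftrightarrow> (s, t) \<in> orbit_rel G"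
  using assms by (simp add: eq_equiv_class_iff[OF equiv_orbit_rel])

text \<open>Two representatives become equal after adding cancelling tuples, and on these
  \<open>class_diff\<close> vanishes by their symmetry.\<close>

lemma orbit_data_diff_class:
  assumes s: "s \<in> orbit_tuples G" and c: "c \<in> nontrivial_classes G"
  shows "orbit_data_diff G c (orbit_rel G `` {s}) = class_diff G c s"
proof -
  let ?t = "SOME t. t \<in> orbit_rel G `` {s}"
  have "s \<in> orbit_rel G `` {s}" using equiv_class_self[OF equiv_orbit_rel s] .
  then have "?t \<in> orbit_rel G `` {s}" by (rule someI)
  then obtain a b where ab: "a \<in> cancelling_tuples G" "b \<in> cancelling_tuples G" "s + a = ?t + b"
    unfolding orbit_rel_def by blast
  have "class_diff G c (s + a) = class_diff G c (?t + b)" using ab(3) by (rule arg_cong)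
  then show ?thesis
    using ab(1,2) c by (simp add: orbit_data_diff_def class_diff_add class_diff_cancelling)
qed

lemma hom_orbit_data_diff:
  assumes "c \<in> nontrivial_classes G"
  shows "orbit_data_diff G c \<in> hom (singular_orbit_data G) integer_group"
proof (rule homI)
  fix U V
  assume "U \<in> carrier (singular_orbit_data G)" "V \<in> carrier (singular_orbit_data G)"
  then obtain s t where "s \<in> orbit_tuples G" "U = orbit_rel G `` {s}"
    "t \<in> orbit_tuples G" "V = orbit_rel G `` {t}"
    by (auto simp: carrier_singular_orbit_data)
  then show "orbit_data_diff G c (U \<otimes>\<^bsub>singular_orbit_data G\<^esub> V) =
      orbit_data_diff G c U \<otimes>\<^bsub>integer_group\<^esub> orbit_data_diff G c V"
    using assms
    by (simp add: mult_singular_orbit_data orbit_data_diff_class orbit_tuples_add class_diff_add)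
qed simp

lemma cancelling_tuples_orbit_tuples:
  assumes "b \<in> cancelling_tuples G"
  shows "b \<in> orbit_tuples G"
proof -
  obtain P where b: "b = \<Sum>\<^sub># P" and P: "set_mset P \<subseteq> cancelling_pairs G"
    using assms by (auto simp: cancelling_tuples_def)
  have "\<Sum>\<^sub># P \<in> orbit_tuples G" using P
  proof (induction P)
    case empty
    then show ?case by (simp add: orbit_tuples_zero)
  next
    case (add a P)
    then obtain x where x: "x \<in> carrier G" "a = class_tuple G [x, inv x]"
      by (auto simp: cancelling_pairs_def)
    have "foldr (\<otimes>) [x, inv x] \<one> \<in> derived G (carrier G)"
      using x subgroup.one_closed[OF subgroup_derived] by simp
    then have "a \<in> orbit_tuples G"
      unfolding orbit_tuples_def mem_Collect_eq using x
      by (intro exI[of _ "[x, inv x]"]) (simp del: foldr.simps)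
    then show ?case using add by (simp add: orbit_tuples_add)
  qed
  then show ?thesis by (simp add: b)
qed

lemma tuple_coset_cancelling:
  "finite (carrier G) \<Longrightarrow> b \<in> cancelling_tuples G \<Longrightarrow> tuple_coset G b = \<one>\<^bsub>abelianization G\<^esub>"
  using cancelling_tuples_orbit_tuples[of b] orbit_tuples_iff[of b] by simp

lemma tuple_coset_add_cancelling:
  assumes "finite (carrier G)" "b \<in> cancelling_tuples G"
  shows "tuple_coset G (s + b) = tuple_coset G s"
proof -
  interpret A: comm_group "abelianization G" by (rule comm_group_abelianization)
  show ?thesis using assms by (simp add: tuple_coset_add tuple_coset_cancelling tuple_coset_closed)
qed

lemma orbit_data_diff_independent:
  assumes fin: "finite (carrier G)" and Tp: "is_T_plus G Tp" and c: "c \<in> Tp"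
  shows "\<exists>U \<in> carrier (singular_orbit_data G). orbit_data_diff G c U \<noteq> 0 \<and>
    (\<forall>d \<in> Tp. d \<noteq> c \<longrightarrow> orbit_data_diff G d U = 0)"
proof -
  have cN: "c \<in> nontrivial_classes G" "class_inv G c \<noteq> c" using T_plus_classes(1)[OF Tp c] by auto
  then obtain x where x: "x \<in> carrier G" "x \<noteq> \<one>" "c = conj_class G x"
    by (auto elim: nontrivial_classesE)
  \<comment> \<open>By Lagrange's theorem the product of this list is the identity, so the tuple is
    admissible whatever the coset of \<open>x\<close> is.\<close>
  let ?s = "class_tuple G (replicate (order G) x)"
  have s: "?s = replicate_mset (order G) c"
    using x by (simp add: class_tuple_def)
  have "foldr (\<otimes>) (replicate n x) \<one> = x [^] n" for n
    using x(1) by (induction n) (simp_all, metis nat_pow_Suc nat_pow_Suc2)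
  then have "foldr (\<otimes>) (replicate (order G) x) \<one> = \<one>"
    using x(1) by (simp add: pow_order_eq_1)
  then have sO: "?s \<in> orbit_tuples G"
    unfolding orbit_tuples_def mem_Collect_eq using x(1) subgroup.one_closed[OF subgroup_derived]
    by (intro exI[of _ "replicate (order G) x"]) (auto simp: set_replicate_conv_if)
  have "order G \<noteq> 0" using fin order_gt_0_iff_finite by blast
  then have "class_diff G c ?s \<noteq> 0" unfolding s class_diff_def using cN by simp
  moreover have "class_diff G d ?s = 0" if "d \<in> Tp" "d \<noteq> c" for d
  proof -
    \<comment> \<open>Otherwise \<open>d\<close> and its inverse \<open>c\<close> would both lie in
      \<open>Tp\<close>.\<close>
    have "class_inv G d \<noteq> c" using T_plus_classes(1)[OF Tp that(1)] c by blast
    then show ?thesis unfolding s class_diff_def using that by simp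
  qed
  moreover have "d \<in> nontrivial_classes G" if "d \<in> Tp" for d using T_plus_classes(1)[OF Tp that] by blast
  ultimately show ?thesis
    using sO cN(1) carrier_singular_orbit_data
    by (intro bexI[of _ "orbit_rel G `` {?s}"]) (auto simp: orbit_data_diff_class)
qed

text \<open>Real classes are fixed by inversion. From every other inverse pair one member lies in
  \<open>Tp\<close>, where the difference vanishes.\<close>

lemma count_class_inv_eq:
  assumes Tp: "is_T_plus G Tp" and diff: "\<And>c. c \<in> Tp \<Longrightarrow> class_diff G c s = 0"
    and c: "c \<in> nontrivial_classes G"
  shows "count s (class_inv G c) = count s c"
proof -
  consider "class_inv G c = c" | "c \<in> Tp" | "class_inv G c \<in> Tp"
    using T_plus_classes(2)[OF Tp c] S_classes_iff by blast
  then show ?thesis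
    using diff[of c] diff[of "class_inv G c"] class_inv_class_inv[OF c]
    by cases (simp_all add: class_diff_def)
qed

text \<open>As multisets, the sum of \<open>A\<close> and \<open>B\<close> is their symmetric
  difference plus twice their intersection. The doubled part consists of real classes, so it cancels
  and has trivial coset.\<close>

lemma hom_tuple_coset_mset_set:
  assumes fin: "finite (carrier G)"
  shows "(\<lambda>A. tuple_coset G (mset_set A)) \<in> hom (sym_diff_group (S_classes G)) (abelianization G)"
proof (rule homI)
  fix A B assume "A \<in> carrier (sym_diff_group (S_classes G))" "B \<in> carrier (sym_diff_group (S_classes G))"
  then have AB: "A \<subseteq> S_classes G" "B \<subseteq> S_classes G" by (auto simp: sym_diff_group_def)
  then have "finite A" "finite B" using finite_S_classes[OF fin] finite_subset by blast+
  then have "mset_set A + mset_set B =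
      mset_set ((A - B) \<union> (B - A)) + (mset_set (A \<inter> B) + mset_set (A \<inter> B))"
    by (intro multiset_eqI) (auto simp: count_mset_set')
  moreover have "mset_set (A \<inter> B) + mset_set (A \<inter> B) \<in> cancelling_tuples G"
  proof -
    have "count (mset_set (A \<inter> B)) (class_inv G c) = count (mset_set (A \<inter> B)) c"
      if "c \<in> nontrivial_classes G" for c
      using that AB S_classes_iff class_inv_class_inv by (auto simp: count_mset_set')
    then show ?thesis
      using AB \<open>finite A\<close> S_classes_iff by (auto simp: cancelling_tuples_iff)
  qed
  ultimately show "tuple_coset G (mset_set (A \<otimes>\<^bsub>sym_diff_group (S_classes G)\<^esub> B)) =
      tuple_coset G (mset_set A) \<otimes>\<^bsub>abelianization G\<^esub> tuple_coset G (mset_set B)"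
    using tuple_coset_add_cancelling[OF fin] by (simp add: sym_diff_group_def flip: tuple_coset_add)
qed (rule tuple_coset_closed)

text \<open>The generators \<open>M_cosets G\<close> are the cosets of real classes, including that
  of the identity. The image of the homomorphism is a subgroup that contains them, and each of its
  members is a product of them.\<close>

lemma K_group_carrier:
  assumes "finite (carrier G)"
  shows "carrier (K_group G) = (\<lambda>A. tuple_coset G (mset_set A)) ` Pow (S_classes G)"
proof -
  let ?A = "abelianization G" and ?D = "derived G (carrier G)"
    and ?h = "\<lambda>A. tuple_coset G (mset_set A)"
  interpret A: comm_group ?A by (rule comm_group_abelianization)
  interpret h: group_hom "sym_diff_group (S_classes G)" ?A ?h
    using hom_tuple_coset_mset_set[OF assms] group_sym_diff_group A.group_axioms
    by (simp add: group_hom_def group_hom_axioms_def)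
  have M: "M_cosets G \<subseteq> carrier ?A" by (auto simp: M_cosets_def)
  have K: "carrier (K_group G) = generate ?A (M_cosets G)"
    using M by (simp add: K_group_def carrier_subgroup_generated Int_absorb1)
  have "class_coset G c \<in> M_cosets G" if c: "c \<in> S_classes G" for c
  proof -
    obtain x where x: "x \<in> carrier G" "conj_class G (inv x) = conj_class G x" "c = conj_class G x"
      using c by (auto simp: S_classes_def)
    have "conj_class G x \<subseteq> class_coset G c"
    proof
      fix y assume y: "y \<in> conj_class G x"
      then have "y \<in> carrier G" using x by (auto simp: conj_class_eq)
      then show "y \<in> class_coset G c"
        using y x(3) rcos_self[OF _ subgroup_derived] by (auto simp: class_coset_def)
    qed
    then show ?thesis
      using x c class_coset_closed S_classes_iff unfolding M_cosets_def by blast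
  qed
  \<comment> \<open>Proved for all multisets of real classes, so that induction can add one class at
    a time.\<close>
  then have "tuple_coset G s \<in> generate ?A (M_cosets G)" if "set_mset s \<subseteq> S_classes G" for s
    using that
  proof (induction s)
    case empty
    then show ?case by (simp add: tuple_coset_empty generate.one)
  next
    case (add c s)
    then have "c \<in> nontrivial_classes G" "class_coset G c \<in> M_cosets G"
      using S_classes_iff by auto
    then have "tuple_coset G ({#c#} + s) \<in> generate ?A (M_cosets G)"
      using add assms unfolding tuple_coset_add
      by (intro generate.eng) (auto simp: tuple_coset_single intro: generate.incl)
    then show ?case by simp
  qed
  moreover have "set_mset (mset_set A) \<subseteq> S_classes G" if "A \<subseteq> S_classes G" for A
    using that by (cases "finite A") auto
  ultimately have "?h ` Pow (S_classes G) \<subseteq> generate ?A (M_cosets G)" by blast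
  moreover have "generate ?A (M_cosets G) \<subseteq> ?h ` Pow (S_classes G)"
  proof (rule A.generate_subgroup_incl)
    show "subgroup (?h ` Pow (S_classes G)) ?A"
      using h.img_is_subgroup by (simp add: sym_diff_group_def)
    show "M_cosets G \<subseteq> ?h ` Pow (S_classes G)"
    proof
      fix C assume "C \<in> M_cosets G"
      then obtain x where x: "x \<in> carrier G" "conj_class G (inv x) = conj_class G x"
        "conj_class G x \<subseteq> C" and "C \<in> carrier ?A" unfolding M_cosets_def by blast
      then obtain y where y: "y \<in> carrier G" "C = ?D #> y"
        by (auto simp: abelianization_def FactGroup_def RCOSETS_def)
      have "x \<in> C" using x conj_class_self by blast
      then have C: "C = ?D #> x" using y repr_independence[OF _ _ subgroup_derived] by simp
      \<comment> \<open>The class of the identity is not in \<open>S_classes G\<close>; its coset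
        comes from the empty set.\<close>
      show "C \<in> ?h ` Pow (S_classes G)"
      proof (cases "x = \<one>")
        case True
        then have "C = ?h {}"
          using C coset_join2[OF one_closed subgroup_derived subgroup.one_closed[OF subgroup_derived]]
          by (simp add: tuple_coset_empty one_abelianization)
        then show ?thesis by blast
      next
        case False
        then have "conj_class G x \<in> S_classes G" using x by (auto simp: S_classes_def)
        moreover have "C = ?h {conj_class G x}"
          using C x False assms
          by (simp add: tuple_coset_single conj_class_nontrivial class_coset_conj_class)
        ultimately show ?thesis by blast
      qed
    qed
  qed
  ultimately show ?thesis using K by simp
qed

section \<open>The common kernel of the difference homomorphisms\<close>

text \<open>The parity of the multiplicity of a real class is unchanged by cancelling tuples and
  determines the element. A bijection of sets is enough here, since a finite group of exponent two
  is determined up to isomorphism by its cardinality.\<close>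

lemma bij_betw_torsion:
  assumes fin: "finite (carrier G)" and Tp: "is_T_plus G Tp"
  shows "bij_betw (\<lambda>A. orbit_rel G `` {mset_set A})
    {A. A \<subseteq> S_classes G \<and> tuple_coset G (mset_set A) = \<one>\<^bsub>abelianization G\<^esub>}
    {U \<in> carrier (singular_orbit_data G). \<forall>c\<in>Tp. orbit_data_diff G c U = 0}"
    (is "bij_betw ?f ?Z ?R")
proof -
  have TN: "c \<in> nontrivial_classes G" if "c \<in> Tp" for c
    using T_plus_classes(1)[OF Tp that] by blast
  have finA: "finite A" if "A \<subseteq> S_classes G" for A
    using that finite_S_classes[OF fin] finite_subset by blast
  have O: "mset_set A \<in> orbit_tuples G" if "A \<in> ?Z" for A
    using that finA S_classes_iff by (auto simp: orbit_tuples_iff[OF fin])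
  have "inj_on ?f ?Z"
  proof (rule inj_onI)
    fix A B assume A: "A \<in> ?Z" and B: "B \<in> ?Z" and "?f A = ?f B"
    then have "(mset_set A, mset_set B) \<in> orbit_rel G"
      using orbit_rel_classes_eq_iff[OF O[OF A] O[OF B]] by simp
    then obtain a b where ab: "a \<in> cancelling_tuples G" "b \<in> cancelling_tuples G"
      "mset_set A + a = mset_set B + b" unfolding orbit_rel_def by blast
    have "c \<in> A \<longleftrightarrow> c \<in> B" if c: "c \<in> S_classes G" for c
    proof -
      have "even (count a c)" "even (count b c)"
        using ab c by (simp_all add: cancelling_tuples_iff)
      moreover have "count (mset_set A) c + count a c = count (mset_set B) c + count b c"
        using arg_cong[OF ab(3), of "\<lambda>s. count s c"] by simp
      ultimately have "even (count (mset_set A) c) \<longleftrightarrow> even (count (mset_set B) c)"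
        by (metis even_add)
      then show ?thesis using A B finA by (auto simp: count_mset_set' split: if_splits)
    qed
    then show "A = B" using A B by blast
  qed
  moreover have "?f A \<in> ?R" if A: "A \<in> ?Z" for A
  proof -
    have "class_diff G c (mset_set A) = 0" if c: "c \<in> Tp" for c
    proof -
      have "c \<notin> S_classes G" "class_inv G c \<notin> S_classes G"
        using T_plus_classes(1)[OF Tp c] S_classes_iff class_inv_class_inv by auto
      then show ?thesis using A by (auto simp: class_diff_def count_mset_set')
    qed
    then show ?thesis using O[OF A] TN by (auto simp: carrier_singular_orbit_data orbit_data_diff_class)
  qed
  moreover have "U \<in> ?f ` ?Z" if U: "U \<in> ?R" for U
  proof -
    obtain s where s: "s \<in> orbit_tuples G" "U = orbit_rel G `` {s}"
      using U by (auto simp: carrier_singular_orbit_data)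
    then have diff: "class_diff G c s = 0" if "c \<in> Tp" for c
      using U that TN orbit_data_diff_class by auto
    \<comment> \<open>The reduced form of \<open>s\<close>: the remainder \<open>b\<close> has even
      multiplicities at real classes and is symmetric under inversion at the others, so it
      cancels.\<close>
    let ?A = "{c \<in> S_classes G. odd (count s c)}"
    have "finite ?A" using finite_S_classes[OF fin] by simp
    then have cA: "count (mset_set ?A) c = (if c \<in> S_classes G \<and> odd (count s c) then 1 else 0)" for c
      by (simp add: count_mset_set')
    have "1 \<le> count s c" if "odd (count s c)" for c
      using that by (cases "count s c") auto
    then have "mset_set ?A \<subseteq># s"
      by (intro mset_subset_eqI) (simp add: cA del: One_nat_def)
    then obtain b where b: "s = mset_set ?A + b" by (metis subset_mset.le_iff_add)
    have cb: "count s c = (if c \<in> S_classes G \<and> odd (count s c) then 1 else 0) + count b c" for c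
      using arg_cong[OF b, of "\<lambda>s. count s c"] cA by simp
    have "b \<in> cancelling_tuples G"
    proof -
      have "set_mset b \<subseteq> nontrivial_classes G"
        using s b orbit_tuples_iff[OF fin] by (metis set_mset_union le_sup_iff)
      moreover have "count b (class_inv G c) = count b c" if c: "c \<in> nontrivial_classes G" for c
      proof (cases "c \<in> S_classes G")
        case True
        then show ?thesis by (simp add: S_classes_iff)
      next
        case False
        then have "class_inv G c \<notin> S_classes G"
          using c class_inv_class_inv[OF c] by (auto simp: S_classes_iff)
        then show ?thesis
          using count_class_inv_eq[OF Tp diff c] cb[of c] cb[of "class_inv G c"] False by simp
      qed
      moreover have "even (count b c)" if "c \<in> S_classes G" for c
        using cb[of c] that by (cases "odd (count s c)") auto
      ultimately show ?thesis by (simp add: cancelling_tuples_iff)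
    qed
    then have "tuple_coset G (mset_set ?A) = tuple_coset G s"
      using tuple_coset_add_cancelling[OF fin, of b "mset_set ?A"] b by simp
    then have A: "?A \<in> ?Z" using s orbit_tuples_iff[OF fin] by auto
    have "mset_set ?A + b = s + {#}" using b by simp
    then have "(mset_set ?A, s) \<in> orbit_rel G"
      unfolding orbit_rel_def
      using O[OF A] s \<open>b \<in> cancelling_tuples G\<close> cancelling_tuples_zero by blast
    then have "?f ?A = U" using s orbit_rel_classes_eq_iff[OF O[OF A] s(1)] by simp
    then show ?thesis using A by blast
  qed
  ultimately show ?thesis unfolding bij_betw_def by blast
qed

text \<open>Vanishing differences make a representative \<open>s\<close> symmetric under inversion.
  Doubling makes all multiplicities even, so \<open>s + s\<close> is cancelling.\<close>

lemma torsion_square: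
  assumes fin: "finite (carrier G)" and Tp: "is_T_plus G Tp"
    and U: "U \<in> carrier (singular_orbit_data G)" "\<And>c. c \<in> Tp \<Longrightarrow> orbit_data_diff G c U = 0"
  shows "U \<otimes>\<^bsub>singular_orbit_data G\<^esub> U = \<one>\<^bsub>singular_orbit_data G\<^esub>"
proof -
  obtain s where s: "s \<in> orbit_tuples G" "U = orbit_rel G `` {s}"
    using U by (auto simp: carrier_singular_orbit_data)
  have "class_diff G c s = 0" if "c \<in> Tp" for c
    using U(2)[OF that] orbit_data_diff_class[OF s(1)] T_plus_classes(1)[OF Tp that] s(2) by simp
  then have "s + s \<in> cancelling_tuples G"
    using count_class_inv_eq[OF Tp] s orbit_tuples_iff[OF fin] by (simp add: cancelling_tuples_iff)
  moreover have "s + s + {#} = {#} + (s + s)" by simp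
  ultimately have "(s + s, {#}) \<in> orbit_rel G"
    unfolding orbit_rel_def
    using s orbit_tuples_add orbit_tuples_zero cancelling_tuples_zero by blast
  then show ?thesis
    using s orbit_rel_classes_eq_iff[OF orbit_tuples_add[OF s(1) s(1)] orbit_tuples_zero]
    by (simp add: mult_singular_orbit_data) (simp add: singular_orbit_data_def)
qed

text \<open>Exponent two gives some power \<open>m\<close> of the group of order two. Comparing
  orders in the kernel-image count for sets of real classes identifies \<open>m\<close>.\<close>

lemma torsion_iso:
  assumes fin: "finite (carrier G)" and Tp: "is_T_plus G Tp"
  shows "(singular_orbit_data G)\<lparr>carrier :=
      {U \<in> carrier (singular_orbit_data G). \<forall>c\<in>Tp. orbit_data_diff G c U = 0}\<rparr>
    \<cong> Z2_power (card (S_classes G) - K_rank G)" (is "?B\<lparr>carrier := ?R\<rparr> \<cong> _")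
proof -
  let ?V = "sym_diff_group (S_classes G)" and ?h = "\<lambda>A. tuple_coset G (mset_set A)"
  interpret B: comm_group ?B by (rule comm_group_singular_orbit_data)
  interpret h: group_hom ?V "abelianization G" ?h
    using hom_tuple_coset_mset_set[OF fin] group_sym_diff_group comm_group_abelianization
    by (simp add: group_hom_def group_hom_axioms_def comm_group_def)
  have finS: "finite (S_classes G)" by (rule finite_S_classes[OF fin])
  have ker: "kernel ?V (abelianization G) ?h =
      {A. A \<subseteq> S_classes G \<and> tuple_coset G (mset_set A) = \<one>\<^bsub>abelianization G\<^esub>}"
    by (auto simp: kernel_def sym_diff_group_def)
  have "subgroup ?R ?B"
  proof -
    \<comment> \<open>An intersection over an empty index set would be the whole type, so empty
      \<open>Tp\<close> is treated apart.\<close>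
    have "subgroup (\<Inter>c\<in>Tp. {U \<in> carrier ?B. orbit_data_diff G c U = 0}) ?B" if "Tp \<noteq> {}"
      using that T_plus_classes(1)[OF Tp] hom_orbit_data_diff
      by (intro B.subgroups_Inter) (auto intro!: hom_integer_kernel_subgroup B.group_axioms)
    moreover have "(\<Inter>c\<in>Tp. {U \<in> carrier ?B. orbit_data_diff G c U = 0}) = ?R" if "Tp \<noteq> {}"
      using that by auto
    ultimately show ?thesis using B.subgroup_self by (cases "Tp = {}") auto
  qed
  moreover have "finite ?R"
    using bij_betw_finite[OF bij_betw_torsion[OF fin Tp]] finS by auto
  moreover have "U \<otimes>\<^bsub>?B\<^esub> U = \<one>\<^bsub>?B\<^esub>" if "U \<in> ?R" for U
    using that by (intro torsion_square[OF fin Tp]) auto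
  ultimately obtain m where m: "?B\<lparr>carrier := ?R\<rparr> \<cong> Z2_power m"
    using B.exponent_two_iso_Z2_power[of ?R] by blast
  have "card (kernel ?V (abelianization G) ?h) = 2 ^ m"
    using bij_betw_same_card[OF bij_betw_torsion[OF fin Tp]] iso_same_card[OF m]
    by (simp add: ker card_Z2_power)
  moreover have "card (?h ` carrier ?V) = 2 ^ K_rank G"
    using iso_same_card[OF K_rank(1)[OF fin]]
    by (simp add: K_group_carrier[OF fin] card_Z2_power sym_diff_group_def)
  moreover have "card (carrier ?V) = 2 ^ card (S_classes G)" "finite (carrier ?V)"
    using finS by (simp_all add: sym_diff_group_def card_Pow)
  ultimately have "(2::nat) ^ (K_rank G + m) = 2 ^ card (S_classes G)"
    using h.card_kernel_image by (simp add: power_add)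
  \<comment> \<open>An equation without subtraction, so the truncated difference in the next line is
    exact.\<close>
  then have "K_rank G + m = card (S_classes G)" by simp
  then have "card (S_classes G) - K_rank G = m" by simp
  then show ?thesis using m by (simp only:)
qed

end

section \<open>Assembling the free part and the exponent-two part\<close>

theorem theorem19:
  fixes G :: "('a, 'b) monoid_scheme" and Tp :: "'a set set"
  assumes "group G" and "finite (carrier G)" and "is_T_plus G Tp"
  shows "singular_orbit_data G \<cong>
    free_abelian_power (card Tp) \<times>\<times> Z2_power (card (S_classes G) - K_rank G)"
proof -
  interpret group G by fact
  let ?B = "singular_orbit_data G"
  have Tp: "c \<in> nontrivial_classes G" if "c \<in> Tp" for c
    using T_plus_classes(1)[OF assms(3) that] by blast
  then have "finite Tp"
    using finite_subset[OF _ finite_nontrivial_classes[OF assms(2)], of Tp] by blast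
  \<comment> \<open>\<open>comm_group_iso_free_kernel\<close> indexes its homomorphisms by numbers,
    so \<open>Tp\<close> is enumerated. Injectivity of \<open>e\<close> makes distinct indices give
    distinct classes.\<close>
  then obtain e where e: "bij_betw e {..<card Tp} Tp"
    using ex_bij_betw_nat_finite by (metis atLeast0LessThan)
  then have eTp: "e i \<in> Tp" if "i < card Tp" for i
    using that bij_betwE by blast
  have all: "(\<forall>i<card Tp. orbit_data_diff G (e i) U = 0) \<longleftrightarrow>
      (\<forall>c\<in>Tp. orbit_data_diff G c U = 0)" for U
  proof -
    have "(\<forall>i<card Tp. orbit_data_diff G (e i) U = 0) \<longleftrightarrow>
        (\<forall>c \<in> e ` {..<card Tp}. orbit_data_diff G c U = 0)" by auto
    then show ?thesis by (simp only: bij_betw_imp_surj_on[OF e])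
  qed
  have inj: "inj_on e {..<card Tp}" using e by (rule bij_betw_imp_inj_on)
  have "?B \<cong> free_abelian_power (card Tp) \<times>\<times>
      ?B\<lparr>carrier := {U \<in> carrier ?B. \<forall>i<card Tp. orbit_data_diff G (e i) U = 0}\<rparr>"
  proof (rule comm_group_iso_free_kernel[OF comm_group_singular_orbit_data])
    fix i assume i: "i < card Tp"
    show "orbit_data_diff G (e i) \<in> hom ?B integer_group"
      using hom_orbit_data_diff Tp eTp[OF i] by blast
    obtain U where U: "U \<in> carrier ?B" "orbit_data_diff G (e i) U \<noteq> 0"
      and zero: "\<forall>d \<in> Tp. d \<noteq> e i \<longrightarrow> orbit_data_diff G d U = 0"
      using orbit_data_diff_independent[OF assms(2,3) eTp[OF i]] by blast
    have "orbit_data_diff G (e j) U = 0" if "j < card Tp" "j \<noteq> i" for j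
    proof -
      have "e j \<noteq> e i" using inj that i by (auto dest: inj_onD)
      then show ?thesis using zero eTp[OF that(1)] by simp
    qed
    then show "\<exists>U\<in>carrier ?B. orbit_data_diff G (e i) U \<noteq> 0 \<and>
        (\<forall>j<card Tp. j \<noteq> i \<longrightarrow> orbit_data_diff G (e j) U = 0)"
      using U by blast
  qed
  then have "?B \<cong> free_abelian_power (card Tp) \<times>\<times>
      ?B\<lparr>carrier := {U \<in> carrier ?B. \<forall>c\<in>Tp. orbit_data_diff G c U = 0}\<rparr>"
    unfolding all .
  also have "\<dots> \<cong> free_abelian_power (card Tp) \<times>\<times> Z2_power (card (S_classes G) - K_rank G)"
    using torsion_iso[OF assms(2,3)]
    by (intro group.DirProd_iso_trans iso_refl) (simp_all add: free_abelian_power_def)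
  finally show ?thesis .
qed

end
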